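(* Suppose that (Smoothness) $\|\nabla f(\mathbf{Y})-\nabla f(\mathbf{X})\|_F\le L\|\mathbf{Y}-\mathbf{X}\|_F$ for all $\mathbf{X},\mathbf{Y}\in\mathbb{R}^{m\times n}$; (Unbiasedness) $\mathbb{E}_k[\mathbf{G}_k\mid\mathcal{F}_{k-1}]=\nabla f(\mathbf{X}_k)$; and (Bounded variance) $\mathbb{E}_k[\|\mathbf{G}_k-\nabla f(\mathbf{X}_k)\|_F^2\mid\mathcal{F}_{k-1}]\le\sigma^2$, for $k=1,\dots,K$. Let $(\mathbf{X}_k)$ be generated by the generalized SOAP algorithm (see context) and suppose that $\sqrt{\mathbf{V}_{k,i,j}+\varepsilon}\ge\delta$ for all $k,i,j$, where $\delta>0$. Let $\gamma\in(0,1]$, $\tau\in(0,1]$, $0<\beta<1$, $$\hat\sigma^2=\max\left\{\sigma^2,\frac{L(f(\mathbf{X}_1)-f^* )}{K\gamma^2}\right\},\quad 1-\theta=\sqrt{\frac{L(f(\mathbf{X}_1)-f^* )}{K\hat\sigma^2}},\quad \eta=\sqrt{\frac{\delta^2(f(\mathbf{X}_1)-f^* )}{4LK\hat\sigma^2}},\quad \varepsilon=\frac{\tau\hat\sigma^2}{m+n}.$$ Then $$\frac1K\sum_{k=1}^K\mathbb{E}\left[\|\nabla f(\mathbf{X}_k)\|_*\right]\le\left(2\sqrt{m+n}+16\frac{\hat\sigma}{\delta}\right)\sqrt[4]{\frac{\hat\sigma^2L(f(\mathbf{X}_1)-f^* )}{K}}.$$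
   Context: Setting: $f:\mathbb{R}^{m\times n}\to\mathbb{R}$ is differentiable and bounded below, $f(\mathbf{X})=\mathbb{E}_{\zeta\sim\mathcal{P}}[f(\mathbf{X};\zeta)]$, $f^*=\inf_{\mathbf{X}}f(\mathbf{X})$; $L>0$, $\sigma\ge0$ are constants and $K\ge1$ is the number of iterations. $\zeta_1,\zeta_2,\dots$ are the random samples, $\mathbf{G}_k\in\mathbb{R}^{m\times n}$ is the stochastic gradient at $\mathbf{X}_k$ computed from $\zeta_k$, $\mathcal{F}_k=\sigma(\zeta_1,\dots,\zeta_k)$ ($\mathcal{F}_0$ trivial), $\mathbb{E}_k[\cdot\mid\mathcal{F}_{k-1}]$ is conditional expectation over $\zeta_k$ given $\mathcal{F}_{k-1}$, and $\mathbb{E}=\mathbb{E}_{\mathcal{F}_K}$. $\mathbf{X}_1$ is deterministic. $\|\cdot\|_F$ is the Frobenius norm and $\|\cdot\|_*$ the nuclear norm. It is understood that $\hat\sigma>0$, so that the parameter formulas make sense. Generalized SOAP algorithm: given hyperparameters $\eta,\theta,\beta,\varepsilon$ and $\mathbf{X}_1$, set $\mathbf{M}_0=\mathbf{0}$, $\mathbf{V}_0=\mathbf{0}$, and for $k=1,\dots,K$: obtain $\mathbf{G}_k$; set $\mathbf{M}_k=\theta\mathbf{M}_{k-1}+(1-\theta)\mathbf{G}_k$; choose arbitrary orthogonal matrices $\mathbf{P}_k\in\mathbb{R}^{m\times m}$, $\mathbf{Q}_k\in\mathbb{R}^{n\times n}$, which may depend on the whole history up to and including $\mathbf{G}_k$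 (i.e. are $\mathcal{F}_k$-measurable); set $\mathbf{V}_k=\beta\mathbf{V}_{k-1}+(1-\beta)(\mathbf{P}_k^\top\mathbf{G}_k\mathbf{Q}_k)^2$ and $$\mathbf{X}_{k+1}=\mathbf{X}_k-\eta\,\mathbf{P}_k\frac{\mathbf{P}_k^\top\mathbf{M}_k\mathbf{Q}_k}{\sqrt{\mathbf{V}_k+\varepsilon}}\mathbf{Q}_k^\top,$$ where the square, square root, addition of $\varepsilon$ and division of matrices are all elementwise. *)

theory Defs
  imports "HOL-Probability.Probability"
begin

text \<open>
  An \<open>m \<times> n\<close> real matrix is an element of \<open>real ^ 'n ^ 'm\<close> with \<open>m = CARD('m)\<close>, \<open>n = CARD('n)\<close>.
  On this type the library's \<open>norm\<close> is the Frobenius norm and \<open>\<bullet>\<close> the Frobenius inner product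
  (see \<open>norm_matrix_frobenius\<close> below), so that \<open>GDERIV f X :> g\<close> says that \<open>g\<close> is the matrix of
  partial derivatives of \<open>f\<close> at \<open>X\<close>.
\<close>

lemma norm_matrix_frobenius:
  fixes A :: "real ^ 'n ^ 'm"
  shows "norm A = sqrt (\<Sum>i\<in>UNIV. \<Sum>j\<in>UNIV. (A $ i $ j)\<^sup>2)"
  by (simp add: norm_vec_def L2_set_def sum_nonneg)

definition eigenspace :: "real ^ 'n ^ 'n \<Rightarrow> real \<Rightarrow> (real ^ 'n) set" where
  "eigenspace B \<mu> = {x. B *v x = \<mu> *\<^sub>R x}"

definition eigenvalues :: "real ^ 'n ^ 'n \<Rightarrow> real set" where
  "eigenvalues B = {\<mu>. \<exists>x\<in>eigenspace B \<mu>. x \<noteq> 0}"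

text \<open>
  The sum of the singular values, i.e. of the square roots of the eigenvalues of \<open>A\<^sup>T A\<close>, each
  repeated according to its multiplicity (geometric and algebraic multiplicity agree, since
  \<open>A\<^sup>T A\<close> is symmetric).  The sum is finite by \<open>finite_eigenvalues_gram\<close>.
\<close>

definition nuclear_norm :: "real ^ 'n ^ 'm \<Rightarrow> real" where
  "nuclear_norm A =
     (\<Sum>\<mu>\<in>eigenvalues (transpose A ** A).
        real (dim (eigenspace (transpose A ** A) \<mu>)) * sqrt \<mu>)"

lemma finite_eigenvalues_gram:
  fixes A :: "real ^ 'n ^ 'm"
  shows "finite (eigenvalues (transpose A ** A))"
proof -
  define B where "B = transpose A ** A"
  have sym: "(B *v x) \<bullet> y = x \<bullet> (B *v y)" for x y
    by (metis B_def dot_lmul_matrix inner_commute matrix_transpose_mul transpose_matrix_vector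
        transpose_transpose)
  define v where "v = (\<lambda>\<mu>. SOME x. x \<in> eigenspace B \<mu> \<and> x \<noteq> 0)"
  have v: "B *v v \<mu> = \<mu> *\<^sub>R v \<mu>" "v \<mu> \<noteq> 0" if "\<mu> \<in> eigenvalues B" for \<mu>
    using that someI_ex[of "\<lambda>x. x \<in> eigenspace B \<mu> \<and> x \<noteq> 0"]
    unfolding eigenvalues_def v_def eigenspace_def by auto
  have orth: "v \<mu> \<bullet> v \<nu> = 0" if "\<mu> \<in> eigenvalues B" "\<nu> \<in> eigenvalues B" "\<mu> \<noteq> \<nu>" for \<mu> \<nu>
  proof -
    have "\<mu> * (v \<mu> \<bullet> v \<nu>) = \<nu> * (v \<mu> \<bullet> v \<nu>)"
      using sym[of "v \<mu>" "v \<nu>"] v(1)[OF that(1)] v(1)[OF that(2)] by simp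
    then show ?thesis using that(3) by simp
  qed
  have inj: "inj_on v (eigenvalues B)"
    by (rule inj_onI) (metis inner_eq_zero_iff orth v(2))
  have "pairwise orthogonal (v ` eigenvalues B)"
    unfolding pairwise_def orthogonal_def using orth by (metis imageE)
  moreover have "0 \<notin> v ` eigenvalues B"
    using v(2) by (metis imageE)
  ultimately have "independent (v ` eigenvalues B)"
    by (rule pairwise_orthogonal_independent)
  then have "finite (v ` eigenvalues B)"
    by (rule independent_imp_finite)
  then show ?thesis
    using finite_imageD[OF _ inj] by (simp add: B_def)
qed

text \<open>
  \<open>sample_filtration M D \<zeta> k\<close> is \<open>\<sigma>(\<zeta>\<^sub>1, \<dots>, \<zeta>\<^sub>k)\<close>; it is trivial for \<open>k = 0\<close>.
\<close>

definition sample_filtration ::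
  "'a measure \<Rightarrow> 'z measure \<Rightarrow> (nat \<Rightarrow> 'a \<Rightarrow> 'z) \<Rightarrow> nat \<Rightarrow> 'a measure" where
  "sample_filtration M D \<zeta> k =
     sigma (space M) (\<Union>i\<in>{1..k}. {\<zeta> i -` A \<inter> space M | A. A \<in> sets D})"

definition mat_cond_exp ::
  "'a measure \<Rightarrow> 'a measure \<Rightarrow> ('a \<Rightarrow> real ^ 'n ^ 'm) \<Rightarrow> 'a \<Rightarrow> real ^ 'n ^ 'm" where
  "mat_cond_exp M F Y \<omega> = (\<chi> i j. real_cond_exp M F (\<lambda>\<omega>'. Y \<omega>' $ i $ j) \<omega>)"

text \<open>
  A single trajectory of the algorithm: \<open>G\<close> are the stochastic gradients, \<open>P\<close>, \<open>Q\<close> the orthogonal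
  matrices, \<open>Mo\<close> and \<open>V\<close> the first and second moments.
\<close>

definition generalized_soap ::
  "nat \<Rightarrow> real \<Rightarrow> real \<Rightarrow> real \<Rightarrow> real \<Rightarrow> real ^ 'n ^ 'm \<Rightarrow>
   (nat \<Rightarrow> real ^ 'n ^ 'm) \<Rightarrow> (nat \<Rightarrow> real ^ 'm ^ 'm) \<Rightarrow> (nat \<Rightarrow> real ^ 'n ^ 'n) \<Rightarrow>
   (nat \<Rightarrow> real ^ 'n ^ 'm) \<Rightarrow> (nat \<Rightarrow> real ^ 'n ^ 'm) \<Rightarrow> (nat \<Rightarrow> real ^ 'n ^ 'm) \<Rightarrow> bool" where
  "generalized_soap K \<eta> \<theta> \<beta> \<epsilon> X\<^sub>1 G P Q Mo V X \<longleftrightarrow>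
     X 1 = X\<^sub>1 \<and> Mo 0 = 0 \<and> V 0 = 0 \<and>
     (\<forall>k\<in>{1..K}.
        Mo k = \<theta> *\<^sub>R Mo (k - 1) + (1 - \<theta>) *\<^sub>R G k \<and>
        orthogonal_matrix (P k) \<and> orthogonal_matrix (Q k) \<and>
        V k = \<beta> *\<^sub>R V (k - 1)
              + (1 - \<beta>) *\<^sub>R (\<chi> i j. ((transpose (P k) ** G k ** Q k) $ i $ j)\<^sup>2) \<and>
        X (k + 1) = X k - \<eta> *\<^sub>R
          (P k ** (\<chi> i j. (transpose (P k) ** Mo k ** Q k) $ i $ j / sqrt (V k $ i $ j + \<epsilon>))
               ** transpose (Q k)))"

end

theory Submission
  imports Defs
begin

text \<open>
  Write \<open>g = P\<^sup>T \<nabla>f Q\<close>, \<open>N = P\<^sup>T M Q\<close> and \<open>d = sqrt (V + \<epsilon>)\<close> entrywise.  The descent lemma and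
  \<open>2 g N = g\<^sup>2 + N\<^sup>2 - (g - N)\<^sup>2\<close> bound the energies \<open>\<Sum> g\<^sup>2 / d\<close> and \<open>\<Sum> N\<^sup>2 / d\<close> along the trajectory by
  the initial gap and the momentum error \<open>\<parallel>M - \<nabla>f\<parallel>\<^sup>2\<close>; the latter obeys a contraction whose
  inhomogeneity consists of \<open>\<Sum> N\<^sup>2 / d\<close>, which is absorbed, a centered cross term and the noise.

  The nuclear norm is orthogonally invariant and at most the sum of the row norms \<open>r\<^sub>i\<close> of \<open>g\<close>.  With
  \<open>W\<^sub>i = \<Sum>\<^sub>j V\<^sub>i\<^sub>j + \<epsilon>\<close> one has \<open>2 r\<^sub>i \<le> s r\<^sub>i\<^sup>2 / sqrt W\<^sub>i + sqrt W\<^sub>i / s\<close>, and \<open>\<Sum>\<^sub>i r\<^sub>i\<^sup>2 / sqrt W\<^sub>i\<close> is at most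
  \<open>\<Sum> g\<^sup>2 / d\<close>.  Finally \<open>sqrt W\<^sub>i = W\<^sub>i / sqrt W\<^sub>i\<close>, where \<open>W\<^sub>i\<close> is controlled by moving averages of
  \<open>r\<^sub>i\<^sup>2\<close> and of the noise; the gradient part summed over time is again at most a multiple of
  \<open>\<Sum> r\<^sub>i\<^sup>2 / sqrt W\<^sub>i\<close>, independently of \<open>\<beta>\<close>.  All these inequalities hold pathwise, so expectations are
  taken only once, at the end.
\<close>

subsection \<open>Duality for the nuclear norm\<close>

text \<open>A maximizer \<open>u\<close> of the Rayleigh quotient on the unit sphere of
  \<open>S\<close> is an eigenvector: otherwise moving it along its residual would increase the
  quotient to first order.\<close>

lemma symmetric_eigenvector_in_subspace:
  fixes B :: "real ^ 'n ^ 'n"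
  assumes sym: "\<And>x y. (B *v x) \<bullet> y = x \<bullet> (B *v y)"
    and S: "subspace S" "\<And>x. x \<in> S \<Longrightarrow> B *v x \<in> S" and z: "z \<in> S" "z \<noteq> 0"
  obtains u \<mu> where "u \<in> S" "u \<noteq> 0" "B *v u = \<mu> *\<^sub>R u"
proof -
  have "compact (S \<inter> sphere 0 1)"
    by (simp add: S(1) closed_subspace closed_Int_compact)
  moreover have "z /\<^sub>R norm z \<in> S \<inter> sphere 0 1"
    using z by (simp add: S(1) subspace_scale)
  moreover have "continuous_on (S \<inter> sphere 0 1) (\<lambda>x. x \<bullet> (B *v x))"
    by (intro continuous_intros)
  ultimately obtain u where u: "u \<in> S" "norm u = 1"
    and max: "\<And>y. y \<in> S \<Longrightarrow> norm y = 1 \<Longrightarrow> y \<bullet> (B *v y) \<le> u \<bullet> (B *v u)"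
    using continuous_attains_sup[of "S \<inter> sphere 0 1" "\<lambda>x. x \<bullet> (B *v x)"] by fastforce
  define \<mu> where "\<mu> = u \<bullet> (B *v u)"
  have form_le: "y \<bullet> (B *v y) \<le> \<mu> * (y \<bullet> y)" if "y \<in> S" for y
  proof (cases "y = 0")
    case False
    have "(y /\<^sub>R norm y) \<bullet> (B *v (y /\<^sub>R norm y)) \<le> \<mu>"
      unfolding \<mu>_def using False that by (intro max) (simp_all add: S(1) subspace_scale)
    then show ?thesis
      using False by (simp add: matrix_vector_mult_scaleR field_simps dot_square_norm power2_eq_square)
  qed simp
  \<comment> \<open>The residual \<open>w\<close> lies in \<open>S\<close> by invariance, so
    \<open>u + t *\<^sub>R w\<close> is an admissible competitor. Comparing the two sides of
    \<open>form_le\<close> there leaves a quadratic in \<open>t\<close> with linear coefficient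
    \<open>- 2 * (w \<bullet> w)\<close>, which is negative unless \<open>w = 0\<close>.\<close>
  define w where "w = B *v u - \<mu> *\<^sub>R u"
  define h where "h = \<mu> * (w \<bullet> w) - w \<bullet> (B *v w)"
  have wS: "w \<in> S"
    unfolding w_def using S u(1) by (simp add: subspace_diff subspace_scale)
  have uu: "u \<bullet> u = 1" using u(2) by (simp add: dot_square_norm)
  have ww: "w \<bullet> (B *v u) - \<mu> * (u \<bullet> w) = w \<bullet> w"
    by (simp add: w_def inner_diff_right inner_commute algebra_simps)
  have h_nonneg: "0 \<le> h" using form_le[OF wS] by (simp add: h_def)
  have quad: "0 \<le> t * t * h - 2 * t * (w \<bullet> w)" for t
  proof -
    have "(u + t *\<^sub>R w) \<bullet> (B *v (u + t *\<^sub>R w)) \<le> \<mu> * ((u + t *\<^sub>R w) \<bullet> (u + t *\<^sub>R w))"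
      by (intro form_le) (simp add: S(1) u(1) wS subspace_add subspace_scale)
    also have "(u + t *\<^sub>R w) \<bullet> (B *v (u + t *\<^sub>R w))
        = \<mu> + 2 * t * (w \<bullet> (B *v u)) + t * t * (w \<bullet> (B *v w))"
      using sym[of u w] inner_commute[of "B *v u" w]
      by (simp add: matrix_vector_right_distrib matrix_vector_mult_scaleR inner_add_left
          inner_add_right \<mu>_def algebra_simps)
    also have "\<mu> * ((u + t *\<^sub>R w) \<bullet> (u + t *\<^sub>R w)) = \<mu> + 2 * t * (\<mu> * (u \<bullet> w)) + t * t * (\<mu> * (w \<bullet> w))"
      by (simp add: inner_add_left inner_add_right uu inner_commute algebra_simps)
    finally have "2 * t * (w \<bullet> (B *v u) - \<mu> * (u \<bullet> w)) \<le> t * t * h"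
      by (simp add: h_def algebra_simps)
    then show ?thesis unfolding ww by simp
  qed
  have "w = 0"
  proof (rule ccontr)
    define q where "q = w \<bullet> w"
    assume "w \<noteq> 0"
    then have q: "q > 0" by (simp add: q_def)
    \<comment> \<open>Small enough that the linear term beats the quadratic one: this
      \<open>t\<close> solves \<open>t * h = q - t * q\<close>. The denominator is positive because
      \<open>h \<ge> 0\<close> and \<open>q > 0\<close>.\<close>
    define t where "t = q / (h + q)"
    have t: "t > 0" "t * h = q - t * q" using q h_nonneg by (auto simp: t_def field_simps)
    have "t * t * h - 2 * t * q = t * (t * h) - 2 * t * q" by simp
    also have "\<dots> = - (t * q * (1 + t))" unfolding t(2) by (simp add: algebra_simps)
    finally have "t * t * h - 2 * t * q = - (t * q * (1 + t))" .
    moreover have "t * q * (1 + t) > 0" using t(1) q by simp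
    ultimately show False using quad[of t] by (simp add: q_def)
  qed
  then have "B *v u = \<mu> *\<^sub>R u" by (simp add: w_def)
  moreover have "u \<noteq> 0" using u(2) by auto
  ultimately show ?thesis using that u(1) by blast
qed

lemma gram_form:
  fixes A :: "real ^ 'n ^ 'm"
  shows "((transpose A ** A) *v x) \<bullet> y = (A *v x) \<bullet> (A *v y)"
  by (simp add: dot_lmul_matrix transpose_matrix_vector flip: matrix_vector_mul_assoc)

text \<open>Orthonormal bases of the eigenspaces of \<open>transpose A ** A\<close> combine into
  right singular vectors of \<open>A\<close>. Their images are orthogonal, and the image of an
  eigenvector for \<open>\<mu>\<close> has length \<open>sqrt \<mu>\<close>, so multiplicities turn
  into a sum over vectors.\<close>

lemma nuclear_norm_eq_sum_singular:
  fixes A :: "real ^ 'n ^ 'm"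
  obtains C where "finite C" "pairwise orthogonal C" "\<And>v. v \<in> C \<Longrightarrow> norm v = 1" "span C = UNIV"
    "\<And>v w. v \<in> C \<Longrightarrow> w \<in> C \<Longrightarrow> v \<noteq> w \<Longrightarrow> (A *v v) \<bullet> (A *v w) = 0"
    "nuclear_norm A = (\<Sum>v\<in>C. norm (A *v v))"
proof -
  define B where "B = transpose A ** A"
  have form: "(B *v x) \<bullet> y = (A *v x) \<bullet> (A *v y)" for x y
    by (simp add: B_def gram_form)
  have sym: "(B *v x) \<bullet> y = x \<bullet> (B *v y)" for x y
    by (metis form inner_commute)
  have sub: "subspace (eigenspace B \<mu>)" for \<mu>
    by (auto simp: subspace_def eigenspace_def matrix_vector_right_distrib
        matrix_vector_mult_scaleR scaleR_add_right)
  have "\<exists>c. c \<subseteq> eigenspace B \<mu> \<and> pairwise orthogonal c \<and> (\<forall>x\<in>c. norm x = 1) \<and>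
      independent c \<and> card c = dim (eigenspace B \<mu>) \<and> span c = eigenspace B \<mu>" for \<mu>
    using orthonormal_basis_subspace[OF sub[of \<mu>]] by metis
  then obtain c where c: "\<And>\<mu>. c \<mu> \<subseteq> eigenspace B \<mu>" "\<And>\<mu>. pairwise orthogonal (c \<mu>)"
      "\<And>\<mu> x. x \<in> c \<mu> \<Longrightarrow> norm x = 1" "\<And>\<mu>. independent (c \<mu>)"
      "\<And>\<mu>. card (c \<mu>) = dim (eigenspace B \<mu>)" "\<And>\<mu>. span (c \<mu>) = eigenspace B \<mu>"
    by metis
  have fin: "finite (eigenvalues B)" unfolding B_def by (rule finite_eigenvalues_gram)
  have finc: "finite (c \<mu>)" for \<mu> using c(4) independent_imp_finite by blast
  define C where "C = (\<Union>\<mu>\<in>eigenvalues B. c \<mu>)"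
  have eig: "B *v v = \<mu> *\<^sub>R v" if "v \<in> c \<mu>" for v \<mu>
    using c(1)[of \<mu>] that by (auto simp: eigenspace_def)
  have orth: "v \<bullet> w = 0" if "v \<in> c \<mu>" "w \<in> c \<nu>" "v \<noteq> w \<or> \<mu> \<noteq> \<nu>" for v w \<mu> \<nu>
  proof (cases "\<mu> = \<nu>")
    case True
    then show ?thesis using c(2)[of \<mu>] that by (auto simp: pairwise_def orthogonal_def)
  next
    case False
    then show ?thesis using sym[of v w] eig[OF that(1)] eig[OF that(2)] by simp
  qed
  have 1: "finite C" unfolding C_def using fin finc by blast
  have 2: "pairwise orthogonal C"
    unfolding C_def pairwise_def orthogonal_def using orth by blast
  have 3: "norm v = 1" if "v \<in> C" for v using that c(3) by (auto simp: C_def)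
  \<comment> \<open>The spectral theorem for \<open>B\<close>: the orthogonal complement of
    \<open>C\<close> is invariant under \<open>B\<close>. Were it nonzero, it would contain an
    eigenvector; that vector would also lie in \<open>span C\<close> and hence be orthogonal to
    itself.\<close>
  have 4: "span C = UNIV"
  proof (rule ccontr)
    assume "span C \<noteq> UNIV"
    then have "span C \<subset> span UNIV" by auto
    then obtain z where z: "z \<noteq> 0" "\<And>y. y \<in> span C \<Longrightarrow> orthogonal z y"
      using orthogonal_to_subspace_exists_gen by metis
    define S where "S = {x. \<forall>v\<in>C. x \<bullet> v = 0}"
    have S: "subspace S" by (auto simp: S_def subspace_def inner_add_left)
    have S2: "B *v x \<in> S" if "x \<in> S" for x
      using that eig by (auto simp: S_def sym C_def)
    have zS: "z \<in> S" using z(2) span_base by (auto simp: S_def orthogonal_def)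
    obtain u \<mu> where u: "u \<in> S" "u \<noteq> 0" "B *v u = \<mu> *\<^sub>R u"
      using symmetric_eigenvector_in_subspace[OF sym S S2 zS z(1)] by blast
    then have "u \<in> eigenspace B \<mu>" by (simp add: eigenspace_def)
    then have "\<mu> \<in> eigenvalues B" "u \<in> span (c \<mu>)"
      using u(2) c(6) by (auto simp: eigenvalues_def)
    then have "u \<in> span C" using span_mono[of "c \<mu>" C] by (auto simp: C_def)
    moreover have "u \<bullet> w = 0" if "w \<in> span C" for w
      using that
    proof (induct rule: span_induct)
      case base show ?case by (simp add: subspace_hyperplane)
    next
      case (step x) then show ?case using u(1) by (simp add: S_def)
    qed
    ultimately have "u \<bullet> u = 0" by blast
    with u(2) show False by simp
  qed
  have 5: "(A *v v) \<bullet> (A *v w) = 0" if "v \<in> C" "w \<in> C" "v \<noteq> w" for v w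
    using that orth eig by (auto simp: C_def simp flip: form)
  have "nuclear_norm A = (\<Sum>\<mu>\<in>eigenvalues B. \<Sum>v\<in>c \<mu>. norm (A *v v))"
    unfolding nuclear_norm_def B_def[symmetric]
  proof (rule sum.cong[OF refl])
    fix \<mu>
    have "norm (A *v v) = sqrt \<mu>" if "v \<in> c \<mu>" for v
      using form[of v v] eig[OF that] c(3)[OF that] by (simp add: norm_eq_sqrt_inner)
    then show "real (dim (eigenspace B \<mu>)) * sqrt \<mu> = (\<Sum>v\<in>c \<mu>. norm (A *v v))"
      by (simp add: c(5))
  qed
  also have "\<dots> = (\<Sum>v\<in>C. norm (A *v v))"
    unfolding C_def
  proof (rule sum.UNION_disjoint[symmetric, OF fin])
    show "\<forall>i\<in>eigenvalues B. \<forall>j\<in>eigenvalues B. i \<noteq> j \<longrightarrow> c i \<inter> c j = {}"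
    proof (intro ballI impI equals0I)
      fix i j v assume "i \<noteq> j" "v \<in> c i \<inter> c j"
      then have "v \<bullet> v = 0" "norm v = 1" using orth[of v i v j] c(3)[of v i] by blast+
      then show False by simp
    qed
  qed (use finc in blast)
  finally show ?thesis using that[OF 1 2 3 4 5] by blast
qed

lemma orthonormal_parseval:
  fixes C :: "'a::euclidean_space set"
  assumes C: "finite C" "pairwise orthogonal C" "\<And>v. v \<in> C \<Longrightarrow> norm v = 1" "span C = UNIV"
  shows "(\<Sum>v\<in>C. (v \<bullet> x) * (v \<bullet> y)) = x \<bullet> y"
proof -
  have "x = (\<Sum>v\<in>C. (v \<bullet> x) *\<^sub>R v)"
    using orthonormal_basis_expand[OF C(2) C(3) _ C(1), of x] C(4) by (simp add: inner_commute)
  then have "x \<bullet> y = (\<Sum>v\<in>C. (v \<bullet> x) *\<^sub>R v) \<bullet> y" by simp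
  then show ?thesis by (simp add: inner_sum_left)
qed

text \<open>Basis independence of the trace of \<open>transpose A ** Z\<close>, obtained from
  Parseval applied to each row.\<close>

lemma frobenius_inner_orthonormal:
  fixes A Z :: "real ^ 'n ^ 'm"
  assumes C: "finite C" "pairwise orthogonal C" "\<And>v. v \<in> C \<Longrightarrow> norm v = 1" "span C = UNIV"
  shows "A \<bullet> Z = (\<Sum>v\<in>C. (A *v v) \<bullet> (Z *v v))"
proof -
  have "(\<Sum>v\<in>C. (A *v v) \<bullet> (Z *v v)) = (\<Sum>i\<in>UNIV. \<Sum>v\<in>C. (v \<bullet> A $ i) * (v \<bullet> Z $ i))"
    by (simp add: inner_vec_def[of "A *v _"] matrix_vector_mul_component inner_commute)
      (rule sum.swap)
  then show ?thesis by (simp add: orthonormal_parseval[OF C] inner_vec_def[of A])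
qed

text \<open>The unit ball of the operator norm, over which the nuclear norm is the maximum of the
  linear functionals \<open>A \<bullet> Z\<close>.\<close>

definition contraction :: "real ^ 'n ^ 'm \<Rightarrow> bool" where
  "contraction Z \<longleftrightarrow> (\<forall>x. norm (Z *v x) \<le> norm x)"

text \<open>Feed \<open>Z\<close> its own row: entry \<open>i\<close> of the image is the squared
  norm of that row, and it is at most the norm of the image.\<close>

lemma contraction_row_norm:
  assumes "contraction Z"
  shows "norm (Z $ i) \<le> 1"
proof -
  have "norm (Z $ i) * norm (Z $ i) = (Z *v (Z $ i)) $ i"
    by (simp add: matrix_vector_mul_component dot_square_norm power2_eq_square)
  also have "\<dots> \<le> norm (Z *v (Z $ i))"
    using component_le_norm_cart[of "Z *v (Z $ i)" i] by simp
  also have "\<dots> \<le> norm (Z $ i)" using assms by (simp add: contraction_def)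
  finally show ?thesis by (cases "Z $ i = 0") auto
qed

text \<open>Evaluate the inner product in the right singular basis of \<open>A\<close> and apply
  Cauchy-Schwarz to each basis vector.\<close>

lemma inner_contraction_le_nuclear_norm:
  fixes A Z :: "real ^ 'n ^ 'm"
  assumes "contraction Z"
  shows "A \<bullet> Z \<le> nuclear_norm A"
proof -
  obtain C where C: "finite C" "pairwise orthogonal C" "\<And>v. v \<in> C \<Longrightarrow> norm v = 1" "span C = UNIV"
    and nuc: "nuclear_norm A = (\<Sum>v\<in>C. norm (A *v v))"
    using nuclear_norm_eq_sum_singular[of A] by metis
  have "(A *v v) \<bullet> (Z *v v) \<le> norm (A *v v)" if "v \<in> C" for v
  proof -
    have "(A *v v) \<bullet> (Z *v v) \<le> norm (A *v v) * norm (Z *v v)" by (rule norm_cauchy_schwarz)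
    also have "\<dots> \<le> norm (A *v v) * norm v"
      using assms by (intro mult_left_mono) (auto simp: contraction_def)
    finally show ?thesis using C(3)[OF that] by simp
  qed
  then have "(\<Sum>v\<in>C. (A *v v) \<bullet> (Z *v v)) \<le> nuclear_norm A"
    unfolding nuc by (rule sum_mono)
  then show ?thesis using frobenius_inner_orthonormal[OF C, of A Z] by simp
qed

text \<open>The maximizer is the partial isometry of the polar decomposition: it sends each right
  singular vector \<open>v\<close> to the direction of \<open>A *v v\<close>, and to zero if
  \<open>A *v v = 0\<close>.\<close>

lemma nuclear_norm_attained:
  fixes A :: "real ^ 'n ^ 'm"
  obtains Z where "contraction Z" "nuclear_norm A = A \<bullet> Z"
proof -
  obtain C where C: "finite C" "pairwise orthogonal C" "\<And>v. v \<in> C \<Longrightarrow> norm v = 1" "span C = UNIV"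
    and orth: "\<And>v w. v \<in> C \<Longrightarrow> w \<in> C \<Longrightarrow> v \<noteq> w \<Longrightarrow> (A *v v) \<bullet> (A *v w) = 0"
    and nuc: "nuclear_norm A = (\<Sum>v\<in>C. norm (A *v v))"
    using nuclear_norm_eq_sum_singular[of A] by metis
  define l where "l = (\<lambda>x. \<Sum>v\<in>C. (v \<bullet> x) *\<^sub>R sgn (A *v v))"
  have "linear l"
    unfolding l_def by (rule linearI) (simp_all add: inner_add_right scaleR_add_left sum.distrib scaleR_sum_right)
  define Z where "Z = matrix l"
  have Z: "Z *v x = l x" for x unfolding Z_def by (rule matrix_works) (simp add: linear_matrix_vector_mul_eq \<open>linear l\<close>)
  \<comment> \<open>The vectors \<open>sgn (A *v v)\<close> are pairwise orthogonal of norm 0 or 1,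
    so the double sum collapses to its diagonal and Parseval applies.\<close>
  have "l x \<bullet> l x \<le> x \<bullet> x" for x
  proof -
    have "l x \<bullet> l x = (\<Sum>v\<in>C. \<Sum>w\<in>C. (v \<bullet> x) * (w \<bullet> x) * (sgn (A *v v) \<bullet> sgn (A *v w)))"
      unfolding l_def inner_sum_left inner_sum_right by (intro sum.cong refl) (simp add: inner_commute)
    also have "\<dots> = (\<Sum>v\<in>C. \<Sum>w\<in>C. if w = v then (v \<bullet> x) * (w \<bullet> x) * (sgn (A *v v) \<bullet> sgn (A *v w)) else 0)"
      using orth by (intro sum.cong refl) (auto simp: sgn_div_norm)
    also have "\<dots> = (\<Sum>v\<in>C. (v \<bullet> x) * (v \<bullet> x) * (sgn (A *v v) \<bullet> sgn (A *v v)))"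
      using C(1) by simp
    also have "\<dots> \<le> (\<Sum>v\<in>C. (v \<bullet> x) * (v \<bullet> x))"
      by (intro sum_mono) (auto simp: dot_square_norm norm_sgn)
    finally show ?thesis by (simp add: orthonormal_parseval[OF C])
  qed
  then have "contraction Z" by (simp add: contraction_def Z norm_le)
  moreover have "l v = sgn (A *v v)" if "v \<in> C" for v
  proof -
    have "l v = (\<Sum>w\<in>C. if w = v then sgn (A *v w) else 0)"
      unfolding l_def using C(2) C(3)[OF that] that
      by (intro sum.cong refl) (auto simp: pairwise_def orthogonal_def dot_square_norm)
    then show ?thesis using C(1) that by simp
  qed
  then have "(A *v v) \<bullet> (Z *v v) = norm (A *v v)" if "v \<in> C" for v
    using that by (cases "A *v v = 0") (simp_all add: Z sgn_div_norm dot_square_norm power2_eq_square)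
  then have "(\<Sum>v\<in>C. (A *v v) \<bullet> (Z *v v)) = nuclear_norm A"
    unfolding nuc by (intro sum.cong refl)
  then have "A \<bullet> Z = nuclear_norm A"
    using frobenius_inner_orthonormal[OF C, of A Z] by simp
  ultimately show ?thesis using that by metis
qed

lemma nuclear_norm_nonneg: "0 \<le> nuclear_norm A"
  using inner_contraction_le_nuclear_norm[of 0 A] by (simp add: contraction_def)

lemma frobenius_inner_le_sum_rows:
  fixes A Z :: "real ^ 'n ^ 'm"
  assumes "contraction Z"
  shows "A \<bullet> Z \<le> (\<Sum>i\<in>UNIV. norm (A $ i))"
  unfolding inner_vec_def[of A]
proof (rule sum_mono)
  fix i
  have "A $ i \<bullet> Z $ i \<le> norm (A $ i) * norm (Z $ i)" by (rule norm_cauchy_schwarz)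
  also have "\<dots> \<le> norm (A $ i) * 1"
    using contraction_row_norm[OF assms] by (rule mult_left_mono) simp
  finally show "A $ i \<bullet> Z $ i \<le> norm (A $ i)" by simp
qed

lemma nuclear_norm_le_sum_rows:
  fixes A :: "real ^ 'n ^ 'm"
  shows "nuclear_norm A \<le> (\<Sum>i\<in>UNIV. norm (A $ i))"
  using nuclear_norm_attained[of A] frobenius_inner_le_sum_rows by metis

lemma nuclear_norm_le_norm:
  fixes A :: "real ^ 'n ^ 'm"
  shows "nuclear_norm A \<le> real CARD('m) * norm A"
proof -
  have "(\<Sum>i\<in>UNIV. norm (A $ i)) \<le> (\<Sum>i\<in>(UNIV :: 'm set). norm A)"
    by (intro sum_mono Finite_Cartesian_Product.norm_nth_le)
  then show ?thesis using nuclear_norm_le_sum_rows[of A] by simp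
qed

text \<open>Serves measurability: the definition through eigenvalues does not show it, but a
  Lipschitz function is Borel. Testing with an optimal \<open>Z\<close> for \<open>A\<close> gives
  subadditivity.\<close>

lemma nuclear_norm_diff_le:
  fixes A B :: "real ^ 'n ^ 'm"
  shows "nuclear_norm A - nuclear_norm B \<le> real CARD('m) * norm (A - B)"
proof -
  obtain Z where Z: "contraction Z" "nuclear_norm A = A \<bullet> Z"
    by (rule nuclear_norm_attained)
  have "nuclear_norm A - nuclear_norm B \<le> (A - B) \<bullet> Z"
    using Z inner_contraction_le_nuclear_norm[OF Z(1), of B] by (simp add: inner_diff_left)
  also have "\<dots> \<le> nuclear_norm (A - B)" by (rule inner_contraction_le_nuclear_norm[OF Z(1)])
  finally show ?thesis using nuclear_norm_le_norm order_trans by blast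
qed

lemma borel_measurable_nuclear_norm [measurable]:
  "(nuclear_norm :: real ^ 'n ^ 'm \<Rightarrow> real) \<in> borel_measurable borel"
proof -
  have "(real CARD('m))-lipschitz_on UNIV (nuclear_norm :: real ^ 'n ^ 'm \<Rightarrow> real)"
  proof (rule lipschitz_onI)
    fix A B :: "real ^ 'n ^ 'm"
    show "dist (nuclear_norm A) (nuclear_norm B) \<le> real CARD('m) * dist A B"
      using nuclear_norm_diff_le[of A B] nuclear_norm_diff_le[of B A]
      by (simp add: dist_norm norm_minus_commute)
  qed simp
  then show ?thesis
    by (intro borel_measurable_continuous_onI lipschitz_on_continuous_on)
qed

subsection \<open>Orthogonal invariance\<close>

lemma frobenius_adjoint_left:
  fixes R :: "real ^ 'k ^ 'm" and A :: "real ^ 'n ^ 'k" and B :: "real ^ 'n ^ 'm"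
  shows "(R ** A) \<bullet> B = A \<bullet> (transpose R ** B)"
proof -
  have "(R ** A) \<bullet> B = (\<Sum>i\<in>UNIV. \<Sum>j\<in>UNIV. \<Sum>l\<in>UNIV. R $ i $ l * A $ l $ j * B $ i $ j)"
    by (simp add: inner_vec_def matrix_matrix_mult_def sum_distrib_right)
  also have "\<dots> = (\<Sum>l\<in>UNIV. \<Sum>j\<in>UNIV. \<Sum>i\<in>UNIV. R $ i $ l * A $ l $ j * B $ i $ j)"
    by (subst sum.swap, subst (2) sum.swap, subst sum.swap, rule refl)
  also have "\<dots> = A \<bullet> (transpose R ** B)"
    by (simp add: inner_vec_def matrix_matrix_mult_def transpose_def sum_distrib_left mult_ac)
  finally show ?thesis .
qed

lemma frobenius_transpose: "transpose A \<bullet> transpose B = A \<bullet> (B :: real ^ 'n ^ 'm)"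
  by (simp add: inner_vec_def transpose_def) (rule sum.swap)

lemma frobenius_adjoint_right:
  fixes A :: "real ^ 'k ^ 'm" and R :: "real ^ 'n ^ 'k" and B :: "real ^ 'n ^ 'm"
  shows "(A ** R) \<bullet> B = A \<bullet> (B ** transpose R)"
proof -
  have "(A ** R) \<bullet> B = (transpose R ** transpose A) \<bullet> transpose B"
    by (simp add: frobenius_transpose flip: matrix_transpose_mul)
  also have "\<dots> = transpose A \<bullet> transpose (B ** transpose R)"
    by (simp add: frobenius_adjoint_left matrix_transpose_mul)
  finally show ?thesis by (simp add: frobenius_transpose)
qed

text \<open>Moves the pairing of the gradient with an update into the rotated frame, where the
  preconditioner acts entrywise.\<close>

lemma orthogonal_sandwich_adjoint:
  fixes A B :: "real ^ 'n ^ 'm"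
  shows "A \<bullet> (P ** B ** transpose Q) = (transpose P ** A ** Q) \<bullet> B"
proof -
  have "(P ** B ** transpose Q) \<bullet> A = (P ** B) \<bullet> (A ** Q)"
    using frobenius_adjoint_right[of "P ** B" "transpose Q" A] by simp
  also have "\<dots> = B \<bullet> (transpose P ** A ** Q)"
    by (simp add: frobenius_adjoint_left matrix_mul_assoc)
  finally show ?thesis by (simp add: inner_commute)
qed

lemma orthogonal_sandwich_inverse:
  fixes A :: "real ^ 'n ^ 'm"
  assumes "orthogonal_matrix P" "orthogonal_matrix Q"
  shows "transpose P ** (P ** A ** transpose Q) ** Q = A"
proof -
  have "transpose P ** (P ** A ** transpose Q) ** Q = (transpose P ** P) ** A ** (transpose Q ** Q)"
    by (simp add: matrix_mul_assoc)
  then show ?thesis using assms by (simp add: orthogonal_matrix_def)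
qed

lemma norm_orthogonal_sandwich:
  fixes A :: "real ^ 'n ^ 'm"
  assumes "orthogonal_matrix P" "orthogonal_matrix Q"
  shows "norm (P ** A ** transpose Q) = norm A"
proof -
  show ?thesis
    using orthogonal_sandwich_inverse[OF assms, of A] orthogonal_sandwich_adjoint[of "P ** A ** transpose Q" P A Q] by (simp add: norm_eq_sqrt_inner)
qed

lemma norm_orthogonal_sandwich':
  fixes A :: "real ^ 'n ^ 'm"
  assumes "orthogonal_matrix P" "orthogonal_matrix Q"
  shows "norm (transpose P ** A ** Q) = norm A"
  using norm_orthogonal_sandwich[of "transpose P" "transpose Q" A] assms by simp

lemma contraction_orthogonal_sandwich:
  fixes Z :: "real ^ 'n ^ 'm"
  assumes "orthogonal_matrix P" "orthogonal_matrix Q" "contraction Z"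
  shows "contraction (transpose P ** Z ** Q)"
proof -
  have iso: "norm (R *v x) = norm x" if "orthogonal_matrix R" for R :: "real ^ 'k ^ 'k" and x
    using that gram_form[of R x x] by (simp add: orthogonal_matrix norm_eq_sqrt_inner)
  show ?thesis
    unfolding contraction_def
  proof
    fix x
    have "norm ((transpose P ** Z ** Q) *v x) = norm (Z *v (Q *v x))"
      using iso[of "transpose P" "Z *v (Q *v x)"] assms(1)
      by (simp add: matrix_vector_mul_assoc matrix_mul_assoc)
    also have "\<dots> \<le> norm (Q *v x)" using assms(3) by (simp add: contraction_def)
    finally show "norm ((transpose P ** Z ** Q) *v x) \<le> norm x" by (simp add: iso[OF assms(2)])
  qed
qed

text \<open>The optimal \<open>Z\<close> is rotated together with \<open>A\<close> and remains a
  contraction, so the row bound may be used in the frame of the preconditioner, however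
  \<open>P\<close> and \<open>Q\<close> were chosen.\<close>

lemma nuclear_norm_le_rotated_rows:
  fixes A :: "real ^ 'n ^ 'm"
  assumes "orthogonal_matrix P" "orthogonal_matrix Q"
  shows "nuclear_norm A \<le> (\<Sum>i\<in>UNIV. norm ((transpose P ** A ** Q) $ i))"
proof -
  obtain Z where Z: "contraction Z" "nuclear_norm A = A \<bullet> Z" by (rule nuclear_norm_attained)
  have "Z = P ** (transpose P ** Z ** Q) ** transpose Q"
    using orthogonal_sandwich_inverse[of "transpose P" "transpose Q" Z] assms by simp
  then have "A \<bullet> Z = (transpose P ** A ** Q) \<bullet> (transpose P ** Z ** Q)"
    using orthogonal_sandwich_adjoint[of A P "transpose P ** Z ** Q" Q] by simp
  then show ?thesis
    using Z frobenius_inner_le_sum_rows[OF contraction_orthogonal_sandwich[OF assms Z(1)]] by simp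
qed

subsection \<open>Smooth functions\<close>

text \<open>On the segment from \<open>X\<close> to \<open>Y\<close> the difference of the two
  sides, \<open>\<phi>\<close>, has nonpositive derivative by Cauchy-Schwarz and the Lipschitz
  bound.\<close>

lemma smooth_descent:
  fixes f :: "'a::real_inner \<Rightarrow> real"
  assumes gradient: "\<And>Y. GDERIV f Y :> grad Y"
    and smooth: "\<And>Y Z. norm (grad Z - grad Y) \<le> L * norm (Z - Y)"
  shows "f Y \<le> f X + grad X \<bullet> (Y - X) + L / 2 * (norm (Y - X))\<^sup>2"
proof -
  define D where "D = Y - X"
  define \<phi> where "\<phi> t = f (X + t *\<^sub>R D) - t * (grad X \<bullet> D) - L / 2 * t\<^sup>2 * (norm D)\<^sup>2" for t
  have "\<phi> 1 \<le> \<phi> 0"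
  proof (rule DERIV_nonpos_imp_nonincreasing[where f = \<phi> and a = 0 and b = 1])
    fix t :: real assume t: "0 \<le> t" "t \<le> 1"
    have "(f has_derivative (\<lambda>h. h \<bullet> grad (X + t *\<^sub>R D))) (at (X + t *\<^sub>R D))"
      using gradient by (simp add: gderiv_def)
    moreover have "((\<lambda>t. X + t *\<^sub>R D) has_derivative (\<lambda>h. h *\<^sub>R D)) (at t)"
      by (auto intro!: derivative_eq_intros)
    ultimately have "((\<lambda>t. f (X + t *\<^sub>R D)) has_derivative (\<lambda>h. h *\<^sub>R D \<bullet> grad (X + t *\<^sub>R D))) (at t)"
      using has_derivative_compose by blast
    then have "DERIV (\<lambda>t. f (X + t *\<^sub>R D)) t :> D \<bullet> grad (X + t *\<^sub>R D)"
      by (simp add: has_field_derivative_def mult_commute_abs)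
    then have "DERIV \<phi> t :> D \<bullet> grad (X + t *\<^sub>R D) - grad X \<bullet> D - L * t * (norm D)\<^sup>2"
      unfolding \<phi>_def by (auto intro!: derivative_eq_intros)
    moreover have "D \<bullet> (grad (X + t *\<^sub>R D) - grad X) \<le> norm D * (L * norm (X + t *\<^sub>R D - X))"
      by (rule order_trans[OF norm_cauchy_schwarz]) (intro mult_left_mono smooth, simp)
    then have "D \<bullet> grad (X + t *\<^sub>R D) - grad X \<bullet> D - L * t * (norm D)\<^sup>2 \<le> 0"
      using t by (simp add: inner_diff_right inner_commute power2_eq_square mult_ac)
    ultimately show "\<exists>y. DERIV \<phi> t :> y \<and> y \<le> 0" by blast
  qed simp
  then show ?thesis by (simp add: \<phi>_def D_def)
qed

text \<open>A gradient step of size \<open>1 / L\<close> decreases \<open>f\<close> by at least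
  \<open>(norm (grad X))\<^sup>2 / (2 * L)\<close> and cannot fall below \<open>c\<close>.\<close>

lemma smooth_gradient_bound:
  fixes f :: "'a::real_inner \<Rightarrow> real"
  assumes gradient: "\<And>Y. GDERIV f Y :> grad Y"
    and smooth: "\<And>Y Z. norm (grad Z - grad Y) \<le> L * norm (Z - Y)"
    and "L > 0" and lower: "\<And>Y. c \<le> f Y"
  shows "(norm (grad X))\<^sup>2 \<le> 2 * L * (f X - c)"
proof -
  define Y where "Y = X - (1 / L) *\<^sub>R grad X"
  have "c \<le> f X + grad X \<bullet> (Y - X) + L / 2 * (norm (Y - X))\<^sup>2"
    using lower[of Y] smooth_descent[OF gradient smooth, of Y X] by linarith
  also have "\<dots> = f X - (norm (grad X))\<^sup>2 / (2 * L)"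
    using \<open>L > 0\<close> by (simp add: Y_def dot_square_norm power_mult_distrib field_simps power2_eq_square)
  finally show ?thesis using \<open>L > 0\<close> by (simp add: field_simps)
qed

subsection \<open>Moving averages\<close>

text \<open>Summing the recursion telescopes up to the boundary term \<open>c * a K\<close>. The
  induction keeps this term to close, and its sign allows dropping it at the end.\<close>

lemma sum_affine_recursion_le:
  fixes a x :: "nat \<Rightarrow> real"
  assumes "0 \<le> c" "a 0 = 0" and nonneg: "\<And>k. k \<in> {1..K} \<Longrightarrow> 0 \<le> a k"
    and rec: "\<And>k. k \<in> {1..K} \<Longrightarrow> a k \<le> c * a (k - 1) + x k"
  shows "(1 - c) * (\<Sum>k=1..K. a k) \<le> (\<Sum>k=1..K. x k)"
proof -
  have "n \<le> K \<Longrightarrow> (1 - c) * (\<Sum>k=1..n. a k) + c * a n \<le> (\<Sum>k=1..n. x k)" for n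
  proof (induct n)
    case (Suc n)
    then show ?case using rec[of "Suc n"] by (simp add: algebra_simps)
  qed (simp add: assms)
  from this[of K] have "(1 - c) * (\<Sum>k=1..K. a k) + c * a K \<le> (\<Sum>k=1..K. x k)" by simp
  moreover have "0 \<le> c * a K" using assms(1,2) nonneg[of K] by (cases "K = 0") auto
  ultimately show ?thesis by linarith
qed

primrec ema :: "real \<Rightarrow> (nat \<Rightarrow> real) \<Rightarrow> nat \<Rightarrow> real" where
  "ema \<beta> x 0 = 0"
| "ema \<beta> x (Suc k) = \<beta> * ema \<beta> x k + (1 - \<beta>) * x (Suc k)"

lemma ema_step: "k \<ge> 1 \<Longrightarrow> ema \<beta> x k = \<beta> * ema \<beta> x (k - 1) + (1 - \<beta>) * x k"
  by (cases k) auto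

lemma ema_nonneg:
  assumes "0 \<le> \<beta>" "\<beta> \<le> 1" "\<And>k. 0 \<le> x k"
  shows "0 \<le> ema \<beta> x k"
  by (induct k) (use assms in auto)

lemma sum_ema_le:
  assumes "0 \<le> \<beta>" "\<beta> < 1" "\<And>k. 0 \<le> x k"
  shows "(\<Sum>k=1..K. ema \<beta> x k) \<le> (\<Sum>k=1..K. x k)"
proof -
  have "(1 - \<beta>) * (\<Sum>k=1..K. ema \<beta> x k) \<le> (\<Sum>k=1..K. (1 - \<beta>) * x k)"
    by (rule sum_affine_recursion_le) (use assms in \<open>auto intro!: ema_nonneg simp del: One_nat_def simp: ema_step[symmetric]\<close>)
  then show ?thesis using assms(2) by (simp flip: sum_distrib_left)
qed

text \<open>
  Since \<open>w k + \<epsilon> \<ge> \<beta> * (w (k - 1) + \<epsilon>)\<close>, the ratio of the moving average of \<open>a\<close> to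
  \<open>sqrt (w k + \<epsilon>)\<close> contracts at rate \<open>sqrt \<beta>\<close>, and \<open>(1 - \<beta>) / (1 - sqrt \<beta>) \<le> 2\<close> makes the
  bound independent of \<open>\<beta>\<close>.
\<close>

lemma sum_sqrt_ema_le:
  fixes w a b h :: "nat \<Rightarrow> real"
  assumes \<beta>: "0 < \<beta>" "\<beta> < 1" and "\<epsilon> \<ge> 0" "c > 0" and w0: "w 0 = 0"
    and rec: "\<And>k. k \<in> {1..K} \<Longrightarrow> w k = \<beta> * w (k - 1) + (1 - \<beta>) * h k"
    and h: "\<And>k. 0 \<le> h k" "\<And>k. h k \<le> 2 * a k + 2 * b k"
    and ab: "\<And>k. 0 \<le> a k" "\<And>k. 0 \<le> b k"
    and pos: "\<And>k. k \<in> {1..K} \<Longrightarrow> 0 < w k + \<epsilon>"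
  shows "(\<Sum>k=1..K. sqrt (w k + \<epsilon>))
    \<le> 4 * (\<Sum>k=1..K. a k / sqrt (w k + \<epsilon>)) + (2 * (\<Sum>k=1..K. b k) + real K * \<epsilon>) / c + real K * c"
proof -
  have ema: "0 \<le> ema \<beta> a k" "0 \<le> ema \<beta> b k" for k
    using \<beta> ab by (auto intro!: ema_nonneg)
  have w_le: "k \<le> K \<Longrightarrow> 0 \<le> w k \<and> w k \<le> 2 * ema \<beta> a k + 2 * ema \<beta> b k" for k
  proof (induct k)
    case (Suc k)
    then have IH: "0 \<le> w k" "w k \<le> 2 * ema \<beta> a k + 2 * ema \<beta> b k" by auto
    have "w (Suc k) = \<beta> * w k + (1 - \<beta>) * h (Suc k)" using rec[of "Suc k"] Suc by simp
    moreover have "\<beta> * w k \<le> \<beta> * (2 * ema \<beta> a k + 2 * ema \<beta> b k)"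
      using IH \<beta> by (intro mult_left_mono) auto
    moreover have "(1 - \<beta>) * h (Suc k) \<le> (1 - \<beta>) * (2 * a (Suc k) + 2 * b (Suc k))"
      using h \<beta> by (intro mult_left_mono) auto
    moreover have "0 \<le> \<beta> * w k" "0 \<le> (1 - \<beta>) * h (Suc k)" using IH \<beta> h by auto
    ultimately show ?case by (simp add: algebra_simps)
  qed (simp add: w0)
  define \<rho> where "\<rho> k = ema \<beta> a k / sqrt (w k + \<epsilon>)" for k
  define q where "q k = a k / sqrt (w k + \<epsilon>)" for k
  have "(1 - sqrt \<beta>) * (\<Sum>k=1..K. \<rho> k) \<le> (\<Sum>k=1..K. (1 - \<beta>) * q k)"
  proof (rule sum_affine_recursion_le)
    fix k assume k: "k \<in> {1..K}"
    show "0 \<le> \<rho> k" using ema pos[OF k] by (simp add: \<rho>_def)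
    have "ema \<beta> a (k - 1) * \<beta> / sqrt (w k + \<epsilon>) \<le> sqrt \<beta> * \<rho> (k - 1)"
    \<comment> \<open>At \<open>k = 1\<close> both sides vanish since
      \<open>ema \<beta> a 0 = 0\<close>. This case stands apart because
      \<open>w 0 + \<epsilon> = \<epsilon>\<close> may be zero, and \<open>pos\<close> starts at
      index 1.\<close>
    proof (cases "k = 1")
      case False
      then have pos': "0 < w (k - 1) + \<epsilon>" using k by (intro pos) auto
      have "\<beta> * (w (k - 1) + \<epsilon>) \<le> w k + \<epsilon>"
      proof -
        have "\<beta> * \<epsilon> \<le> \<epsilon>" "0 \<le> (1 - \<beta>) * h k"
          using \<open>\<epsilon> \<ge> 0\<close> \<beta> h by (auto simp: mult_left_le_one_le)
        then show ?thesis using rec[OF k] by (simp add: algebra_simps)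
      qed
      then have "sqrt \<beta> * sqrt (w (k - 1) + \<epsilon>) \<le> sqrt (w k + \<epsilon>)"
        by (simp flip: real_sqrt_mult)
      then have "ema \<beta> a (k - 1) * \<beta> / sqrt (w k + \<epsilon>)
          \<le> ema \<beta> a (k - 1) * \<beta> / (sqrt \<beta> * sqrt (w (k - 1) + \<epsilon>))"
        using ema \<beta> pos' pos[OF k] by (intro divide_left_mono) auto
      also have "\<dots> = sqrt \<beta> * \<rho> (k - 1)"
      proof -
        have cancel: "x * (b * b) / (b * y) = b * (x / y)" if "b \<noteq> 0" for x y b :: real
          using that by simp
        show ?thesis
          using \<beta> cancel[of "sqrt \<beta>" "ema \<beta> a (k - 1)" "sqrt (w (k - 1) + \<epsilon>)"] by (simp add: \<rho>_def)
      qed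
      finally show ?thesis .
    qed (simp add: \<rho>_def)
    then show "\<rho> k \<le> sqrt \<beta> * \<rho> (k - 1) + (1 - \<beta>) * q k"
      using k by (simp add: \<rho>_def q_def ema_step add_divide_distrib mult_ac)
  qed (use \<beta> in \<open>auto simp: \<rho>_def\<close>)
  also have "\<dots> = (1 - sqrt \<beta>) * ((1 + sqrt \<beta>) * (\<Sum>k=1..K. q k))"
  proof -
    have "(1 - sqrt \<beta>) * (1 + sqrt \<beta>) = 1 - \<beta>" using \<beta> by (simp add: algebra_simps)
    then show ?thesis by (simp add: mult.assoc[symmetric] sum_distrib_left)
  qed
  finally have "(\<Sum>k=1..K. \<rho> k) \<le> (1 + sqrt \<beta>) * (\<Sum>k=1..K. q k)"
    using \<beta> by simp
  also have "\<dots> \<le> 2 * (\<Sum>k=1..K. q k)"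
    using \<beta> ab pos by (intro mult_right_mono sum_nonneg) (auto simp: q_def less_imp_le)
  finally have \<rho>_sum: "(\<Sum>k=1..K. \<rho> k) \<le> 2 * (\<Sum>k=1..K. q k)" .
  \<comment> \<open>The free number \<open>c\<close> is a threshold: if the root \<open>s\<close> is
    at least \<open>c\<close>, then \<open>s = s * s / s\<close> and the noise part may be divided
    by \<open>c\<close> in place of \<open>s\<close>; otherwise \<open>s < c\<close> already
    suffices.\<close>
  have "sqrt (w k + \<epsilon>) \<le> 2 * \<rho> k + (2 * ema \<beta> b k + \<epsilon>) / c + c" if k: "k \<in> {1..K}" for k
  proof -
    define s where "s = sqrt (w k + \<epsilon>)"
    have s: "s > 0" "s * s = w k + \<epsilon>" using pos[OF k] by (auto simp: s_def)
    have \<rho>: "\<rho> k = ema \<beta> a k / s" by (simp add: \<rho>_def s_def)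
    have u: "0 \<le> 2 * ema \<beta> b k + \<epsilon>" using ema(2)[of k] \<open>\<epsilon> \<ge> 0\<close> by simp
    show ?thesis
    proof (cases "s \<ge> c")
      case True
      have "s * s \<le> 2 * ema \<beta> a k + (2 * ema \<beta> b k + \<epsilon>)" using s w_le[of k] k by simp
      then have "s \<le> 2 * \<rho> k + (2 * ema \<beta> b k + \<epsilon>) / s"
        using s by (simp add: \<rho> field_simps)
      also have "(2 * ema \<beta> b k + \<epsilon>) / s \<le> (2 * ema \<beta> b k + \<epsilon>) / c"
        using True u \<open>c > 0\<close> s by (intro divide_left_mono) auto
      finally show ?thesis using \<open>c > 0\<close> by (simp add: s_def)
    next
      case False
      have "0 \<le> \<rho> k" "0 \<le> (2 * ema \<beta> b k + \<epsilon>) / c"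
        using ema s u \<open>c > 0\<close> by (auto simp: \<rho>)
      with False show ?thesis by (simp add: s_def)
    qed
  qed
  then have "(\<Sum>k=1..K. sqrt (w k + \<epsilon>)) \<le> (\<Sum>k=1..K. 2 * \<rho> k + (2 * ema \<beta> b k + \<epsilon>) / c + c)"
    by (rule sum_mono)
  also have "\<dots> = 2 * (\<Sum>k=1..K. \<rho> k) + (2 * (\<Sum>k=1..K. ema \<beta> b k) + real K * \<epsilon>) / c + real K * c"
    by (simp add: sum.distrib sum_distrib_left sum_divide_distrib[symmetric])
  also have "\<dots> \<le> 2 * (2 * (\<Sum>k=1..K. q k)) + (2 * (\<Sum>k=1..K. b k) + real K * \<epsilon>) / c + real K * c"
    using \<rho>_sum sum_ema_le[of \<beta> b K] \<beta> ab \<open>c > 0\<close>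
    by (intro add_mono divide_right_mono mult_left_mono) auto
  finally show ?thesis by (simp add: q_def)
qed

subsection \<open>Adaptive preconditioning\<close>

text \<open>The squared norm in the metric of the inverse preconditioner; \<open>A\<close> is meant
  to be given in the rotated frame, like \<open>V\<close>.\<close>

definition weighted_sq :: "real ^ 'n ^ 'm \<Rightarrow> real \<Rightarrow> real ^ 'n ^ 'm \<Rightarrow> real" where
  "weighted_sq V \<epsilon> A = (\<Sum>i\<in>UNIV. \<Sum>j\<in>UNIV. (A $ i $ j)\<^sup>2 / sqrt (V $ i $ j + \<epsilon>))"

lemma norm_matrix_sq:
  fixes A :: "real ^ 'n ^ 'm"
  shows "(norm A)\<^sup>2 = (\<Sum>i\<in>UNIV. \<Sum>j\<in>UNIV. (A $ i $ j)\<^sup>2)"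
  by (simp add: norm_matrix_frobenius sum_nonneg)

lemma norm_row_sq: "(norm ((A :: real ^ 'n ^ 'm) $ i))\<^sup>2 = (\<Sum>j\<in>UNIV. (A $ i $ j)\<^sup>2)"
  by (simp add: norm_vec_def L2_set_def sum_nonneg)

lemma matrix_sandwich_diff:
  fixes A B :: "real ^ 'n ^ 'm"
  shows "R ** (A - B) ** Q = R ** A ** Q - R ** B ** Q"
  by (simp add: matrix_matrix_mult_def vec_eq_iff sum_subtractf algebra_simps)

text \<open>Of the two factors \<open>sqrt (V $ i $ j + \<epsilon>)\<close> in each denominator one
  is replaced by \<open>\<delta>\<close>; the other remains as the weight.\<close>

lemma preconditioned_step_length:
  fixes N V :: "real ^ 'n ^ 'm"
  assumes "\<delta> > 0" and \<delta>: "\<And>i j. \<delta> \<le> sqrt (V $ i $ j + \<epsilon>)"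
  shows "(norm (\<chi> i j. N $ i $ j / sqrt (V $ i $ j + \<epsilon>)))\<^sup>2 \<le> weighted_sq V \<epsilon> N / \<delta>"
  unfolding weighted_sq_def norm_matrix_sq sum_divide_distrib
proof (intro sum_mono)
  fix i :: 'm and j :: 'n
  define d where "d = sqrt (V $ i $ j + \<epsilon>)"
  have d: "\<delta> \<le> d" using \<delta> by (simp add: d_def)
  have "(N $ i $ j)\<^sup>2 / d / d \<le> (N $ i $ j)\<^sup>2 / d / \<delta>"
    using d \<open>\<delta> > 0\<close> less_le_trans[OF \<open>\<delta> > 0\<close> d] by (intro divide_left_mono) auto
  then show "((\<chi> i j. N $ i $ j / sqrt (V $ i $ j + \<epsilon>)) $ i $ j)\<^sup>2
      \<le> (N $ i $ j)\<^sup>2 / sqrt (V $ i $ j + \<epsilon>) / \<delta>"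
    by (simp add: d_def power_divide power2_eq_square)
qed

text \<open>Entrywise polarization of the product \<open>g * N\<close>. Only the negative square
  gives up its weight for \<open>\<delta>\<close>, so that the momentum error appears in the plain
  Frobenius norm.\<close>

lemma preconditioned_inner_ge:
  fixes g N V :: "real ^ 'n ^ 'm"
  assumes "\<delta> > 0" and \<delta>: "\<And>i j. \<delta> \<le> sqrt (V $ i $ j + \<epsilon>)"
  shows "weighted_sq V \<epsilon> g / 2 + weighted_sq V \<epsilon> N / 2 - (norm (g - N))\<^sup>2 / (2 * \<delta>)
    \<le> g \<bullet> (\<chi> i j. N $ i $ j / sqrt (V $ i $ j + \<epsilon>))"
  unfolding weighted_sq_def norm_matrix_sq sum_divide_distrib inner_vec_def sum.distrib[symmetric]
    sum_subtractf[symmetric] inner_real_def vec_lambda_beta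
proof (intro sum_mono)
  fix i :: 'm and j :: 'n
  define d where "d = sqrt (V $ i $ j + \<epsilon>)"
  have d: "\<delta> \<le> d" using \<delta> by (simp add: d_def)
  then have "d > 0" using \<open>\<delta> > 0\<close> by simp
  have "(g $ i $ j - N $ i $ j)\<^sup>2 / (2 * d) \<le> (g $ i $ j - N $ i $ j)\<^sup>2 / (2 * \<delta>)"
    using d \<open>d > 0\<close> \<open>\<delta> > 0\<close> by (intro divide_left_mono) auto
  moreover have "(g $ i $ j)\<^sup>2 / d / 2 + (N $ i $ j)\<^sup>2 / d / 2 - (g $ i $ j - N $ i $ j)\<^sup>2 / (2 * d)
      = g $ i $ j * (N $ i $ j / d)"
    using \<open>d > 0\<close> by (simp add: field_simps power2_eq_square)
  ultimately show "(g $ i $ j)\<^sup>2 / sqrt (V $ i $ j + \<epsilon>) / 2 + (N $ i $ j)\<^sup>2 / sqrt (V $ i $ j + \<epsilon>) / 2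
      - ((g - N) $ i $ j)\<^sup>2 / (2 * \<delta>) \<le> g $ i $ j * (N $ i $ j / sqrt (V $ i $ j + \<epsilon>))"
    by (simp add: d_def[symmetric])
qed

lemma weighted_sq_nonneg:
  assumes "\<And>i j. 0 \<le> V $ i $ j + \<epsilon>"
  shows "0 \<le> weighted_sq V \<epsilon> A"
  unfolding weighted_sq_def using assms by (intro sum_nonneg) auto

subsection \<open>A single trajectory\<close>

text \<open>One sample path, free of probability. The learning rate is expressed through
  \<open>1 - \<theta>\<close>, and \<open>\<theta> < 1\<close> excludes the degenerate case of a
  stationary start.\<close>

locale soap_trajectory =
  fixes f :: "real ^ 'n ^ 'm \<Rightarrow> real"
    and grad :: "real ^ 'n ^ 'm \<Rightarrow> real ^ 'n ^ 'm"
    and G Mo V X :: "nat \<Rightarrow> real ^ 'n ^ 'm"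
    and P :: "nat \<Rightarrow> real ^ 'm ^ 'm"
    and Q :: "nat \<Rightarrow> real ^ 'n ^ 'n"
    and X\<^sub>1 :: "real ^ 'n ^ 'm" and K :: nat
    and L \<delta> \<beta> \<theta> \<eta> \<epsilon> f_star :: real
  assumes gradient: "\<And>Y. GDERIV f Y :> grad Y"
    and smooth: "\<And>Y Z. norm (grad Z - grad Y) \<le> L * norm (Z - Y)"
    and lower: "\<And>Y. f_star \<le> f Y"
    and L: "L > 0" and \<beta>: "0 < \<beta>" "\<beta> < 1" and \<theta>: "0 \<le> \<theta>" "\<theta> < 1"
    and \<eta>: "\<eta> = \<delta> * (1 - \<theta>) / (2 * L)" and \<epsilon>: "\<epsilon> \<ge> 0"
    and soap: "generalized_soap K \<eta> \<theta> \<beta> \<epsilon> X\<^sub>1 G P Q Mo V X"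
    and \<delta>: "\<delta> > 0" "\<And>k i j. k \<in> {1..K} \<Longrightarrow> \<delta> \<le> sqrt (V k $ i $ j + \<epsilon>)"
begin

abbreviation rotated_grad :: "nat \<Rightarrow> real ^ 'n ^ 'm" where
  "rotated_grad k \<equiv> transpose (P k) ** grad (X k) ** Q k"

abbreviation noise :: "nat \<Rightarrow> real ^ 'n ^ 'm" where
  "noise k \<equiv> G k - grad (X k)"

text \<open>The part of the momentum error \<open>Mo k - grad (X k)\<close> that is determined
  before \<open>G k\<close> is drawn; the remainder is \<open>(1 - \<theta>)\<close> times the
  noise.\<close>

abbreviation drift :: "nat \<Rightarrow> real ^ 'n ^ 'm" where
  "drift k \<equiv> \<theta> *\<^sub>R (Mo (k - 1) - grad (X k))"

abbreviation grad_energy :: "nat \<Rightarrow> real" where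
  "grad_energy k \<equiv> weighted_sq (V k) \<epsilon> (rotated_grad k)"

abbreviation step_energy :: "nat \<Rightarrow> real" where
  "step_energy k \<equiv> weighted_sq (V k) \<epsilon> (transpose (P k) ** Mo k ** Q k)"

abbreviation momentum_error :: "nat \<Rightarrow> real" where
  "momentum_error k \<equiv> (norm (Mo k - grad (X k)))\<^sup>2"

lemma init: "X 1 = X\<^sub>1" "Mo 0 = 0" "V 0 = 0"
  using soap by (auto simp: generalized_soap_def)

lemma step:
  assumes "k \<in> {1..K}"
  shows "Mo k = \<theta> *\<^sub>R Mo (k - 1) + (1 - \<theta>) *\<^sub>R G k"
    and "orthogonal_matrix (P k)" "orthogonal_matrix (Q k)"
    and "V k = \<beta> *\<^sub>R V (k - 1)
              + (1 - \<beta>) *\<^sub>R (\<chi> i j. ((transpose (P k) ** G k ** Q k) $ i $ j)\<^sup>2)"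
    and "X (k + 1) = X k - \<eta> *\<^sub>R
          (P k ** (\<chi> i j. (transpose (P k) ** Mo k ** Q k) $ i $ j / sqrt (V k $ i $ j + \<epsilon>))
               ** transpose (Q k))"
  using soap assms unfolding generalized_soap_def by blast+

lemma V_nonneg: "k \<le> K \<Longrightarrow> 0 \<le> V k $ i $ j"
proof (induct k)
  case (Suc k)
  then show ?case using \<beta> step(4)[of "Suc k"] by simp
qed (simp add: init)

lemma V_pos: "k \<in> {1..K} \<Longrightarrow> 0 < V k $ i $ j + \<epsilon>"
  using \<delta>(2)[of k i j] \<delta>(1) by (metis less_le_trans real_sqrt_gt_0_iff)

lemma step_energy_nonneg: "k \<in> {1..K} \<Longrightarrow> 0 \<le> step_energy k"
  using V_pos by (intro weighted_sq_nonneg) (simp add: less_imp_le)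

lemma \<eta>_pos: "\<eta> > 0"
  using \<eta> \<delta>(1) \<theta>(2) L by simp

section \<open>Descent and momentum error along one path\<close>

lemma step_length:
  assumes k: "k \<in> {1..K}"
  shows "(norm (X (k + 1) - X k))\<^sup>2 \<le> \<eta>\<^sup>2 * step_energy k / \<delta>"
proof -
  have "(norm (X (k + 1) - X k))\<^sup>2
      = \<eta>\<^sup>2 * (norm (\<chi> i j. (transpose (P k) ** Mo k ** Q k) $ i $ j / sqrt (V k $ i $ j + \<epsilon>)))\<^sup>2"
    unfolding step(5)[OF k] by (simp add: power_mult_distrib norm_orthogonal_sandwich[OF step(2,3)[OF k]])
  also have "\<dots> \<le> \<eta>\<^sup>2 * (step_energy k / \<delta>)"
    using \<delta> k by (intro mult_left_mono preconditioned_step_length) auto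
  finally show ?thesis by simp
qed

text \<open>The descent lemma with the inner product polarized in the rotated frame. Half of the
  resulting step energy pays for the quadratic term of the descent lemma; the other half is kept to
  absorb the momentum error later.\<close>

lemma descent:
  assumes k: "k \<in> {1..K}"
  shows "\<eta> / 2 * grad_energy k + \<eta> / 4 * step_energy k
    \<le> f (X k) - f (X (k + 1)) + \<eta> / (2 * \<delta>) * momentum_error k"
proof -
  define H where "H = (\<chi> i j. (transpose (P k) ** Mo k ** Q k) $ i $ j / sqrt (V k $ i $ j + \<epsilon>))"
  have "norm (rotated_grad k - transpose (P k) ** Mo k ** Q k) = norm (Mo k - grad (X k))"
    unfolding matrix_sandwich_diff[symmetric]
    by (simp add: norm_orthogonal_sandwich'[OF step(2,3)[OF k]] norm_minus_commute)
  then have "grad_energy k / 2 + step_energy k / 2 - momentum_error k / (2 * \<delta>) \<le> rotated_grad k \<bullet> H"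
    using preconditioned_inner_ge[where V = "V k" and \<delta> = \<delta> and \<epsilon> = \<epsilon> and g = "rotated_grad k"
        and N = "transpose (P k) ** Mo k ** Q k"] \<delta> k
    by (simp add: H_def)
  then have "\<eta> * (grad_energy k / 2 + step_energy k / 2 - momentum_error k / (2 * \<delta>)) \<le> \<eta> * (rotated_grad k \<bullet> H)"
    using \<eta>_pos by (intro mult_left_mono) auto
  moreover have "grad (X k) \<bullet> (X (k + 1) - X k) = - (\<eta> * (rotated_grad k \<bullet> H))"
    unfolding step(5)[OF k] H_def by (simp add: orthogonal_sandwich_adjoint)
  moreover have "L / 2 * (norm (X (k + 1) - X k))\<^sup>2 \<le> \<eta> / 4 * step_energy k"
  proof -
    have "L / 2 * (norm (X (k + 1) - X k))\<^sup>2 \<le> L / 2 * (\<eta>\<^sup>2 * step_energy k / \<delta>)"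
      using step_length[OF k] L by (intro mult_left_mono) auto
    \<comment> \<open>Replacing one factor \<open>\<eta>\<close> by
      \<open>\<delta> * (1 - \<theta>) / (2 * L)\<close> cancels \<open>L\<close> and
      \<open>\<delta>\<close>.\<close>
    also have "\<dots> = \<eta> / 4 * step_energy k * (1 - \<theta>)"
      using L \<delta>(1) by (simp add: \<eta> field_simps power2_eq_square)
    also have "\<dots> \<le> \<eta> / 4 * step_energy k"
      using step_energy_nonneg[OF k] \<eta>_pos \<theta> by (intro mult_left_le) auto
    finally show ?thesis .
  qed
  moreover have "f (X (k + 1)) \<le> f (X k) + grad (X k) \<bullet> (X (k + 1) - X k) + L / 2 * (norm (X (k + 1) - X k))\<^sup>2"
    by (rule smooth_descent[OF gradient smooth])
  ultimately show ?thesis by (simp add: algebra_simps)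
qed

lemma sum_descent:
  "\<eta> / 2 * (\<Sum>k=1..K. grad_energy k) + \<eta> / 4 * (\<Sum>k=1..K. step_energy k)
    \<le> f X\<^sub>1 - f_star + \<eta> / (2 * \<delta>) * (\<Sum>k=1..K. momentum_error k)"
proof -
  have "(\<Sum>k=1..K. \<eta> / 2 * grad_energy k + \<eta> / 4 * step_energy k)
      \<le> (\<Sum>k=1..K. f (X k) - f (X (k + 1)) + \<eta> / (2 * \<delta>) * momentum_error k)"
    by (intro sum_mono descent)
  also have "\<dots> = (\<Sum>k=1..K. f (X k) - f (X (k + 1))) + \<eta> / (2 * \<delta>) * (\<Sum>k=1..K. momentum_error k)"
    by (simp add: sum.distrib sum_distrib_left)
  also have "(\<Sum>k=1..K. f (X k) - f (X (k + 1))) = f X\<^sub>1 - f (X (K + 1))"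
    by (induct K) (simp_all add: init[simplified])
  finally show ?thesis using lower[of "X (K + 1)"] by (simp add: sum.distrib sum_distrib_left)
qed

text \<open>The cross term is kept exactly, not estimated, because its expectation vanishes.\<close>

lemma momentum_error_split:
  assumes k: "k \<in> {1..K}"
  shows "momentum_error k = (norm (drift k))\<^sup>2 + 2 * (1 - \<theta>) * (drift k \<bullet> noise k)
    + (1 - \<theta>)\<^sup>2 * (norm (noise k))\<^sup>2"
proof -
  have "Mo k - grad (X k) = drift k + (1 - \<theta>) *\<^sub>R noise k"
    unfolding step(1)[OF k] by (simp add: algebra_simps)
  moreover have "(norm (D + p *\<^sub>R R))\<^sup>2 = (norm D)\<^sup>2 + 2 * p * (D \<bullet> R) + p\<^sup>2 * (norm R)\<^sup>2"
    for D R :: "real ^ 'n ^ 'm" and p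
    unfolding power2_norm_eq_inner
    by (simp add: inner_add_left inner_add_right inner_commute power2_eq_square algebra_simps)
  ultimately show ?thesis by presburger
qed

text \<open>The source of the contraction: passing from \<open>X (k - 1)\<close> to
  \<open>X k\<close> changes the gradient by at most \<open>L\<close> times the last step, which the
  step energy controls. At \<open>k = 1\<close> there is no last step.\<close>

lemma drift_le:
  assumes k: "k \<in> {1..K}" "k \<noteq> 1"
  shows "(norm (drift k))\<^sup>2 \<le> \<theta> * momentum_error (k - 1)
    + L\<^sup>2 * \<eta>\<^sup>2 / ((1 - \<theta>) * \<delta>) * step_energy (k - 1)"
proof -
  define A where "A = Mo (k - 1) - grad (X (k - 1))"
  define B where "B = grad (X (k - 1)) - grad (X k)"
  have p: "1 - \<theta> > 0" using \<theta> by simp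
  have k1: "k - 1 \<in> {1..K}" "k - 1 + 1 = k" using k by auto
  have "norm (drift k) = norm (\<theta> *\<^sub>R A + \<theta> *\<^sub>R B)"
    by (simp add: A_def B_def flip: scaleR_add_right)
  also have "\<dots> \<le> \<theta> * norm A + \<theta> * norm B"
    using norm_triangle_ineq[of "\<theta> *\<^sub>R A" "\<theta> *\<^sub>R B"] \<theta> by simp
  also have "\<dots> \<le> \<theta> * norm A + norm B"
    using \<theta> by (simp add: mult_left_le_one_le)
  finally have "(norm (drift k))\<^sup>2 \<le> (\<theta> * norm A + norm B)\<^sup>2"
    by (intro power_mono) auto
  \<comment> \<open>Convexity of the square with weights \<open>\<theta>\<close> and
    \<open>1 - \<theta>\<close> at the points \<open>norm A\<close> and
    \<open>norm B / (1 - \<theta>)\<close>, written as an identity with its defect.\<close>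
  also have "\<dots> = \<theta> * (norm A)\<^sup>2 + (norm B)\<^sup>2 / (1 - \<theta>)
      - \<theta> / (1 - \<theta>) * ((1 - \<theta>) * norm A - norm B)\<^sup>2"
  proof -
    have "((1 - p) * a + b)\<^sup>2 = (1 - p) * a\<^sup>2 + b\<^sup>2 / p - (1 - p) / p * (p * a - b)\<^sup>2"
      if "p > 0" for a b p :: real
      using that by (simp add: field_simps power2_eq_square)
    from this[OF p] show ?thesis by simp
  qed
  also have "\<dots> \<le> \<theta> * (norm A)\<^sup>2 + (norm B)\<^sup>2 / (1 - \<theta>)"
    using p \<theta> by simp
  finally have split: "(norm (drift k))\<^sup>2 \<le> \<theta> * (norm A)\<^sup>2 + (norm B)\<^sup>2 / (1 - \<theta>)" .
  have "(norm B)\<^sup>2 \<le> L\<^sup>2 * (\<eta>\<^sup>2 * step_energy (k - 1) / \<delta>)"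
  proof -
    have "(norm B)\<^sup>2 \<le> (L * norm (X k - X (k - 1)))\<^sup>2"
      using smooth[of "X k" "X (k - 1)"] by (intro power_mono) (simp_all add: B_def norm_minus_commute)
    also have "\<dots> \<le> L\<^sup>2 * (\<eta>\<^sup>2 * step_energy (k - 1) / \<delta>)"
      unfolding power_mult_distrib using step_length[OF k1(1)] k1(2) by (intro mult_left_mono) auto
    finally show ?thesis .
  qed
  then have "(norm B)\<^sup>2 / (1 - \<theta>) \<le> L\<^sup>2 * (\<eta>\<^sup>2 * step_energy (k - 1) / \<delta>) / (1 - \<theta>)"
    using p by (intro divide_right_mono) auto
  also have "\<dots> = L\<^sup>2 * \<eta>\<^sup>2 / ((1 - \<theta>) * \<delta>) * step_energy (k - 1)"
    using p \<delta>(1) by (simp add: divide_simps)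
  finally show ?thesis using split unfolding A_def by linarith
qed

text \<open>Summed form of the contraction with factor \<open>\<theta>\<close>. The first term on
  the right is the cost of starting the momentum at zero.\<close>

lemma sum_momentum_error:
  "(1 - \<theta>) * (\<Sum>k=1..K. momentum_error k)
    \<le> 2 * L * (f X\<^sub>1 - f_star) + L\<^sup>2 * \<eta>\<^sup>2 / ((1 - \<theta>) * \<delta>) * (\<Sum>k=1..K. step_energy k)
      + 2 * (1 - \<theta>) * (\<Sum>k=1..K. drift k \<bullet> noise k) + (1 - \<theta>)\<^sup>2 * (\<Sum>k=1..K. (norm (noise k))\<^sup>2)"
proof -
  define c where "c = L\<^sup>2 * \<eta>\<^sup>2 / ((1 - \<theta>) * \<delta>)"
  \<comment> \<open>Index 0 is overwritten by zero because \<open>X 0\<close> and \<open>P 0\<close>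
    are unconstrained. The initial error enters instead through \<open>\<iota>\<close>, at index 1
    only.\<close>
  define e where "e k = (if k = 0 then 0 else momentum_error k)" for k
  define \<tau> where "\<tau> k = (if k = 0 then 0 else step_energy k)" for k
  define \<iota> where "\<iota> k = (if k = 1 then 2 * L * (f X\<^sub>1 - f_star) else 0)" for k :: nat
  have c: "c \<ge> 0" using \<theta> \<delta>(1) by (simp add: c_def)
  have \<tau>: "0 \<le> \<tau> k" if "k \<le> K" for k using that step_energy_nonneg by (auto simp: \<tau>_def)
  define x where "x k = \<iota> k + c * \<tau> (k - 1) + (2 * (1 - \<theta>) * (drift k \<bullet> noise k) + (1 - \<theta>)\<^sup>2 * (norm (noise k))\<^sup>2)" for k
  have "(1 - \<theta>) * (\<Sum>k=1..K. e k) \<le> (\<Sum>k=1..K. x k)"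
  proof (rule sum_affine_recursion_le)
    fix k assume k: "k \<in> {1..K}"
    have "(norm (drift k))\<^sup>2 \<le> \<theta> * e (k - 1) + \<iota> k + c * \<tau> (k - 1)"
    proof (cases "k = 1")
      case True
      \<comment> \<open>With zero initial momentum the first drift is \<open>- \<theta>\<close>
        times the initial gradient, which the initial gap bounds.\<close>
      have "(norm (drift k))\<^sup>2 = \<theta>\<^sup>2 * (norm (grad X\<^sub>1))\<^sup>2"
        using True init(1) by (simp add: init(2) power_mult_distrib)
      also have "\<dots> \<le> (norm (grad X\<^sub>1))\<^sup>2"
        using \<theta> by (intro mult_left_le_one_le) (auto intro: power_le_one)
      also have "\<dots> \<le> 2 * L * (f X\<^sub>1 - f_star)"
        by (rule smooth_gradient_bound[OF gradient smooth L lower])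
      finally show ?thesis using True by (simp add: e_def \<tau>_def \<iota>_def)
    next
      case False
      then have "k - 1 \<noteq> 0" using k by auto
      then show ?thesis using drift_le[OF k False] False by (simp add: e_def \<tau>_def \<iota>_def c_def)
    qed
    then show "e k \<le> \<theta> * e (k - 1) + x k"
      using momentum_error_split[OF k] k by (simp add: e_def x_def)
  qed (use \<theta> in \<open>auto simp: e_def\<close>)
  also have "(\<Sum>k=1..K. x k) = (\<Sum>k=1..K. \<iota> k) + c * (\<Sum>k=1..K. \<tau> (k - 1))
      + (2 * (1 - \<theta>) * (\<Sum>k=1..K. drift k \<bullet> noise k) + (1 - \<theta>)\<^sup>2 * (\<Sum>k=1..K. (norm (noise k))\<^sup>2))"
    by (simp add: x_def sum.distrib sum_distrib_left)
  also have "(\<Sum>k=1..K. \<iota> k) \<le> 2 * L * (f X\<^sub>1 - f_star)"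
    using lower[of X\<^sub>1] L by (simp add: \<iota>_def)
  also have "(\<Sum>k=1..K. \<tau> (k - 1)) \<le> (\<Sum>k=1..K. \<tau> k)"
  proof -
    have "(\<Sum>k=1..n. \<tau> (k - 1)) + \<tau> n = (\<Sum>k=1..n. \<tau> k)" for n
      by (induct n) (simp_all add: \<tau>_def[of 0])
    from this[of K] \<tau>[of K] show ?thesis by linarith
  qed
  finally have "(1 - \<theta>) * (\<Sum>k=1..K. e k) \<le> 2 * L * (f X\<^sub>1 - f_star) + c * (\<Sum>k=1..K. \<tau> k)
      + (2 * (1 - \<theta>) * (\<Sum>k=1..K. drift k \<bullet> noise k) + (1 - \<theta>)\<^sup>2 * (\<Sum>k=1..K. (norm (noise k))\<^sup>2))"
    using c by (simp add: mult_left_mono)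
  moreover have "(\<Sum>k=1..K. e k) = (\<Sum>k=1..K. momentum_error k)"
    "(\<Sum>k=1..K. \<tau> k) = (\<Sum>k=1..K. step_energy k)"
    by (auto intro!: sum.cong simp: e_def \<tau>_def)
  ultimately show ?thesis unfolding c_def by (simp only: add.assoc)
qed

text \<open>Inserting the momentum bound into the summed descent creates step energy with
  coefficient \<open>\<eta> / 8\<close>, below the \<open>\<eta> / 4\<close> available on the left,
  so the loop closes and only the gap, the cross terms and the noise remain.\<close>

lemma sum_grad_energy:
  "\<eta> / 2 * (\<Sum>k=1..K. grad_energy k) \<le> (f X\<^sub>1 - f_star) + (1 / (4 * L)) *
    (2 * L * (f X\<^sub>1 - f_star) + 2 * (1 - \<theta>) * (\<Sum>k=1..K. drift k \<bullet> noise k)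
      + (1 - \<theta>)\<^sup>2 * (\<Sum>k=1..K. (norm (noise k))\<^sup>2))"
proof -
  define B where "B = 2 * L * (f X\<^sub>1 - f_star) + 2 * (1 - \<theta>) * (\<Sum>k=1..K. drift k \<bullet> noise k)
      + (1 - \<theta>)\<^sup>2 * (\<Sum>k=1..K. (norm (noise k))\<^sup>2)"
  define T where "T = (\<Sum>k=1..K. step_energy k)"
  define E where "E = (\<Sum>k=1..K. momentum_error k)"
  have p: "1 - \<theta> > 0" using \<theta> by simp
  have T: "T \<ge> 0" unfolding T_def by (intro sum_nonneg step_energy_nonneg)
  \<comment> \<open>The learning rate is proportional to \<open>1 - \<theta>\<close>, exactly the
    factor on the left of \<open>sum_momentum_error\<close>.\<close>
  have "\<eta> / (2 * \<delta>) * E = 1 / (4 * L) * ((1 - \<theta>) * E)"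
    using L \<delta>(1) by (simp add: \<eta> field_simps)
  also have "\<dots> \<le> 1 / (4 * L) * (B + L\<^sup>2 * \<eta>\<^sup>2 / ((1 - \<theta>) * \<delta>) * T)"
    using sum_momentum_error L unfolding E_def B_def T_def by (intro mult_left_mono) auto
  also have "\<dots> = 1 / (4 * L) * B + \<eta> / 8 * T"
    using L \<delta>(1) p by (simp add: \<eta> field_simps power2_eq_square)
  also have "\<dots> \<le> 1 / (4 * L) * B + \<eta> / 4 * T"
    using T \<eta>_pos by simp
  finally show ?thesis
    using sum_descent unfolding B_def[symmetric] T_def[symmetric] E_def[symmetric] by linarith
qed

section \<open>From energies to the nuclear norm\<close>

lemma sum_row_energy_le:
  assumes k: "k \<in> {1..K}"
  shows "(\<Sum>i\<in>UNIV. (norm (rotated_grad k $ i))\<^sup>2 / sqrt ((\<Sum>j\<in>UNIV. V k $ i $ j) + \<epsilon>)) \<le> grad_energy k"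
  unfolding weighted_sq_def norm_row_sq sum_divide_distrib
proof (intro sum_mono divide_left_mono)
  fix i :: 'm and j :: 'n
  \<comment> \<open>A row sum of the nonnegative \<open>V k\<close> dominates each of its entries,
    so a common denominator for the row only decreases the quotients.\<close>
  have "V k $ i $ j \<le> (\<Sum>j\<in>UNIV. V k $ i $ j)"
    using V_nonneg[of k] k by (intro member_le_sum) auto
  then show "sqrt (V k $ i $ j + \<epsilon>) \<le> sqrt ((\<Sum>j\<in>UNIV. V k $ i $ j) + \<epsilon>)"
    and "0 < sqrt ((\<Sum>j\<in>UNIV. V k $ i $ j) + \<epsilon>) * sqrt (V k $ i $ j + \<epsilon>)"
    using V_pos[OF k, of i j] by auto
qed auto

text \<open>The weight \<open>s\<close> balances the two terms of Young's inequality for the row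
  norms: \<open>s / 2\<close> comes from the row energy, \<open>2 / s\<close> from the gradient part
  of the summed roots, namely 4 times \<open>1 / (2 * s)\<close>. The number \<open>c\<close> is the
  threshold of \<open>sum_sqrt_ema_le\<close>.\<close>

lemma sum_nuclear_norm_le:
  assumes s: "s > 0" and c: "c > 0"
  shows "(\<Sum>k=1..K. nuclear_norm (grad (X k)))
    \<le> (s / 2 + 2 / s) * (\<Sum>k=1..K. grad_energy k)
      + (1 / (2 * s)) * ((2 * (\<Sum>k=1..K. (norm (noise k))\<^sup>2) + real CARD('m) * (real K * \<epsilon>)) / c
          + real CARD('m) * (real K * c))"
proof -
  define w where "w i k = (\<Sum>j\<in>UNIV. V k $ i $ j)" for i k
  define r where "r i k = norm (rotated_grad k $ i)" for i k
  define z where "z i k = (norm ((transpose (P k) ** noise k ** Q k) $ i))\<^sup>2" for i k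
  define A where "A = (\<Sum>k=1..K. grad_energy k)"
  have w_pos: "0 < w i k + \<epsilon>" if k: "k \<in> {1..K}" for i k
  proof -
    \<comment> \<open>Any single entry of the row serves as witness of positivity.\<close>
    have "V k $ i $ undefined \<le> w i k"
      unfolding w_def using V_nonneg[of k] k by (intro member_le_sum) auto
    then show ?thesis using V_pos[OF k, of i undefined] by linarith
  qed
  \<comment> \<open>Each row sum of \<open>V\<close> is itself a moving average, driven by the
    squared row norms of the rotated stochastic gradient. These split into gradient and noise at the
    price of a factor 2.\<close>
  have w_bound: "(\<Sum>k=1..K. sqrt (w i k + \<epsilon>)) \<le> 4 * (\<Sum>k=1..K. (r i k)\<^sup>2 / sqrt (w i k + \<epsilon>))
      + (2 * (\<Sum>k=1..K. z i k) + real K * \<epsilon>) / c + real K * c" for i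
  proof (rule sum_sqrt_ema_le[OF \<beta> \<epsilon> c, where h = "\<lambda>k. (norm ((transpose (P k) ** G k ** Q k) $ i))\<^sup>2"])
    show "w i 0 = 0" by (simp add: w_def init)
    show "w i k = \<beta> * w i (k - 1) + (1 - \<beta>) * (norm ((transpose (P k) ** G k ** Q k) $ i))\<^sup>2"
      if "k \<in> {1..K}" for k
      unfolding w_def step(4)[OF that]
      by (simp add: norm_row_sq sum.distrib sum_distrib_left)
    show "(norm ((transpose (P k) ** G k ** Q k) $ i))\<^sup>2 \<le> 2 * (r i k)\<^sup>2 + 2 * z i k" for k
    proof -
      have "(transpose (P k) ** G k ** Q k) $ i
          = rotated_grad k $ i + (transpose (P k) ** noise k ** Q k) $ i"
        unfolding matrix_sandwich_diff by simp
      then have "(norm ((transpose (P k) ** G k ** Q k) $ i))\<^sup>2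
          \<le> (r i k + norm ((transpose (P k) ** noise k ** Q k) $ i))\<^sup>2"
        by (intro power_mono) (simp_all add: r_def norm_triangle_ineq)
      also have "\<dots> \<le> 2 * (r i k)\<^sup>2 + 2 * z i k"
        unfolding z_def by (smt (verit) power2_diff power2_sum zero_le_power2)
      finally show ?thesis .
    qed
  qed (use w_pos in \<open>auto simp: z_def\<close>)
  have r_le: "r i k \<le> s / 2 * ((r i k)\<^sup>2 / sqrt (w i k + \<epsilon>)) + 1 / (2 * s) * sqrt (w i k + \<epsilon>)"
    if k: "k \<in> {1..K}" for i k
  proof -
    define y where "y = sqrt (w i k + \<epsilon>)"
    have y: "y > 0" using w_pos[OF k] by (simp add: y_def)
    have "0 \<le> (s * r i k - y)\<^sup>2 / (2 * s * y)" using s y by simp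
    also have "\<dots> = s / 2 * ((r i k)\<^sup>2 / y) + 1 / (2 * s) * y - r i k"
      using s y by (simp add: field_simps power2_eq_square)
    finally show ?thesis by (simp add: y_def)
  qed
  have q_le: "(\<Sum>i\<in>UNIV. \<Sum>k=1..K. (r i k)\<^sup>2 / sqrt (w i k + \<epsilon>)) \<le> A"
    unfolding A_def r_def w_def by (subst sum.swap) (intro sum_mono sum_row_energy_le)
  have z_eq: "(\<Sum>i\<in>UNIV. \<Sum>k=1..K. z i k) = (\<Sum>k=1..K. (norm (noise k))\<^sup>2)"
  proof -
    have "(\<Sum>i\<in>UNIV. z i k) = (norm (noise k))\<^sup>2" if "k \<in> {1..K}" for k
      using norm_orthogonal_sandwich'[OF step(2,3)[OF that], of "noise k"]
      by (simp add: z_def norm_row_sq flip: norm_matrix_sq)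
    then show ?thesis by (subst sum.swap) simp
  qed
  have "(\<Sum>k=1..K. nuclear_norm (grad (X k))) \<le> (\<Sum>k=1..K. \<Sum>i\<in>UNIV. r i k)"
    unfolding r_def by (intro sum_mono nuclear_norm_le_rotated_rows step)
  also have "\<dots> = (\<Sum>i\<in>UNIV. \<Sum>k=1..K. r i k)" by (rule sum.swap)
  also have "\<dots> \<le> (\<Sum>i\<in>UNIV. \<Sum>k=1..K.
      s / 2 * ((r i k)\<^sup>2 / sqrt (w i k + \<epsilon>)) + 1 / (2 * s) * sqrt (w i k + \<epsilon>))"
    by (intro sum_mono r_le)
  also have "\<dots> = s / 2 * (\<Sum>i\<in>UNIV. \<Sum>k=1..K. (r i k)\<^sup>2 / sqrt (w i k + \<epsilon>))
      + 1 / (2 * s) * (\<Sum>i\<in>UNIV. \<Sum>k=1..K. sqrt (w i k + \<epsilon>))"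
    by (simp add: sum.distrib sum_distrib_left)
  finally have split: "(\<Sum>k=1..K. nuclear_norm (grad (X k)))
      \<le> s / 2 * (\<Sum>i\<in>UNIV. \<Sum>k=1..K. (r i k)\<^sup>2 / sqrt (w i k + \<epsilon>))
      + 1 / (2 * s) * (\<Sum>i\<in>UNIV. \<Sum>k=1..K. sqrt (w i k + \<epsilon>))" .
  define R where "R = (2 * (\<Sum>k=1..K. (norm (noise k))\<^sup>2) + real CARD('m) * (real K * \<epsilon>)) / c
      + real CARD('m) * (real K * c)"
  have "(\<Sum>i\<in>UNIV. \<Sum>k=1..K. sqrt (w i k + \<epsilon>))
      \<le> (\<Sum>i\<in>UNIV. 4 * (\<Sum>k=1..K. (r i k)\<^sup>2 / sqrt (w i k + \<epsilon>))
        + (2 * (\<Sum>k=1..K. z i k) + real K * \<epsilon>) / c + real K * c)"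
    by (intro sum_mono w_bound)
  also have "\<dots> = 4 * (\<Sum>i\<in>UNIV. \<Sum>k=1..K. (r i k)\<^sup>2 / sqrt (w i k + \<epsilon>)) + R"
    unfolding R_def
    by (simp add: sum.distrib sum_distrib_left[symmetric] sum_divide_distrib[symmetric] z_eq
        del: One_nat_def)
  also have "\<dots> \<le> 4 * A + R" using q_le by simp
  finally have "1 / (2 * s) * (\<Sum>i\<in>UNIV. \<Sum>k=1..K. sqrt (w i k + \<epsilon>)) \<le> 1 / (2 * s) * (4 * A + R)"
    using s by (intro mult_left_mono) auto
  moreover have "s / 2 * (\<Sum>i\<in>UNIV. \<Sum>k=1..K. (r i k)\<^sup>2 / sqrt (w i k + \<epsilon>)) \<le> s / 2 * A"
    using s q_le by (intro mult_left_mono) auto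
  moreover have "s / 2 * A + 1 / (2 * s) * (4 * A + R) = (s / 2 + 2 / s) * A + 1 / (2 * s) * R"
    by (simp add: algebra_simps)
  ultimately show ?thesis using split unfolding A_def R_def by linarith
qed

text \<open>A crude linear growth bound, from which square integrability of the iterates follows by
  induction.\<close>

lemma step_norm_le:
  assumes k: "k \<in> {1..K}"
  shows "norm (X (k + 1)) \<le> norm (X k) + \<eta> / \<delta> * norm (Mo k)"
proof -
  have "step_energy k \<le> (norm (transpose (P k) ** Mo k ** Q k))\<^sup>2 / \<delta>"
    unfolding weighted_sq_def norm_matrix_sq sum_divide_distrib
    using \<delta>(1) \<delta>(2)[OF k] V_pos[OF k] by (intro sum_mono divide_left_mono) auto
  then have "step_energy k \<le> (norm (Mo k))\<^sup>2 / \<delta>"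
    by (simp add: norm_orthogonal_sandwich'[OF step(2,3)[OF k]])
  then have "\<eta>\<^sup>2 / \<delta> * step_energy k \<le> \<eta>\<^sup>2 / \<delta> * ((norm (Mo k))\<^sup>2 / \<delta>)"
    using \<delta>(1) by (intro mult_left_mono) auto
  also have "\<dots> = (\<eta> / \<delta> * norm (Mo k))\<^sup>2" by (simp add: power2_eq_square)
  finally have "(norm (X (k + 1) - X k))\<^sup>2 \<le> (\<eta> / \<delta> * norm (Mo k))\<^sup>2"
    using step_length[OF k] by simp
  then have "norm (X (k + 1) - X k) \<le> \<eta> / \<delta> * norm (Mo k)"
    by (rule power2_le_imp_le) (use \<eta>_pos \<delta>(1) in auto)
  then show ?thesis using norm_triangle_ineq[of "X k" "X (k + 1) - X k"] by simp
qed

end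

subsection \<open>Measurability and square integrability\<close>

lemma borel_measurable_chi:
  fixes A :: "'m::finite \<Rightarrow> 'n::finite \<Rightarrow> 'a \<Rightarrow> real"
  assumes "\<And>i j. A i j \<in> borel_measurable N"
  shows "(\<lambda>\<omega>. (\<chi> i j. A i j \<omega>) :: real ^ 'n ^ 'm) \<in> borel_measurable N"
proof (rule borel_measurable_euclidean_space[THEN iffD2], rule ballI)
  fix b :: "real ^ 'n ^ 'm" assume "b \<in> Basis"
  then obtain i j where b: "b = axis i (axis j 1)" by (auto simp: Basis_vec_def)
  have "(\<chi> i j. A i j \<omega>) \<bullet> b = A i j \<omega>" for \<omega> by (simp add: b inner_axis)
  then show "(\<lambda>\<omega>. (\<chi> i j. A i j \<omega>) \<bullet> b) \<in> borel_measurable N" using assms by simp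
qed

lemma borel_measurable_entry:
  fixes A :: "'a \<Rightarrow> real ^ 'n ^ 'm"
  assumes "A \<in> borel_measurable N"
  shows "(\<lambda>\<omega>. A \<omega> $ i $ j) \<in> borel_measurable N"
proof -
  have "(\<lambda>B :: real ^ 'n ^ 'm. B $ i $ j) \<in> borel_measurable borel"
    by (intro borel_measurable_continuous_onI continuous_intros)
  then show ?thesis using assms by (rule measurable_compose_rev)
qed

lemma borel_measurable_matrix_mult:
  fixes A :: "'a \<Rightarrow> real ^ 'k ^ 'm" and B :: "'a \<Rightarrow> real ^ 'n ^ 'k"
  assumes "A \<in> borel_measurable N" "B \<in> borel_measurable N"
  shows "(\<lambda>\<omega>. A \<omega> ** B \<omega>) \<in> borel_measurable N"
  unfolding matrix_matrix_mult_def
  by (intro borel_measurable_chi borel_measurable_sum borel_measurable_times borel_measurable_entry assms)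

lemma borel_measurable_transpose:
  fixes A :: "'a \<Rightarrow> real ^ 'n ^ 'm"
  assumes "A \<in> borel_measurable N"
  shows "(\<lambda>\<omega>. transpose (A \<omega>)) \<in> borel_measurable N"
  unfolding transpose_def by (intro borel_measurable_chi borel_measurable_entry assms)

lemma subalgebra_sample_filtration:
  assumes "\<And>k. k \<ge> 1 \<Longrightarrow> \<zeta> k \<in> measurable M D"
  shows "subalgebra M (sample_filtration M D \<zeta> k)"
proof -
  define E where "E = (\<Union>i\<in>{1..k}. {\<zeta> i -` A \<inter> space M |A. A \<in> sets D})"
  have "E \<subseteq> sets M" unfolding E_def using assms by (auto simp: measurable_sets)
  then have "sigma_sets (space M) E \<subseteq> sets M" by (rule sets.sigma_sets_subset)
  moreover have "E \<subseteq> Pow (space M)" unfolding E_def by auto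
  ultimately show ?thesis
    unfolding subalgebra_def sample_filtration_def E_def[symmetric] by simp
qed

lemma sample_filtration_mono:
  assumes "i \<le> j"
  shows "subalgebra (sample_filtration M D \<zeta> j) (sample_filtration M D \<zeta> i)"
proof -
  have "(\<Union>i\<in>{1..k}. {\<zeta> i -` A \<inter> space M |A. A \<in> sets D}) \<subseteq> Pow (space M)" for k by auto
  moreover have "(\<Union>k\<in>{1..i}. {\<zeta> k -` A \<inter> space M |A. A \<in> sets D})
      \<subseteq> (\<Union>k\<in>{1..j}. {\<zeta> k -` A \<inter> space M |A. A \<in> sets D})"
    using assms by (intro UN_mono) auto
  ultimately show ?thesis
    unfolding subalgebra_def sample_filtration_def by (simp add: sigma_sets_mono')
qed

section \<open>Square integrability and centered products\<close>

definition sq_integrable :: "'a measure \<Rightarrow> ('a \<Rightarrow> 'b::real_normed_vector) \<Rightarrow> bool" where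
  "sq_integrable M Z \<longleftrightarrow> integrable M (\<lambda>\<omega>. (norm (Z \<omega>))\<^sup>2)"

lemma sq_integrable_bound:
  fixes Z :: "'a \<Rightarrow> 'b::euclidean_space"
  assumes "Z \<in> borel_measurable M" "sq_integrable M A" "sq_integrable M B"
    and le: "AE \<omega> in M. norm (Z \<omega>) \<le> a * norm (A \<omega>) + b * norm (B \<omega>)"
  shows "sq_integrable M Z"
  unfolding sq_integrable_def
proof (rule Bochner_Integration.integrable_bound)
  show "integrable M (\<lambda>\<omega>. 2 * a\<^sup>2 * (norm (A \<omega>))\<^sup>2 + 2 * b\<^sup>2 * (norm (B \<omega>))\<^sup>2)"
    using assms(2,3) by (simp add: sq_integrable_def)
  show "AE \<omega> in M. norm ((norm (Z \<omega>))\<^sup>2) \<le> norm (2 * a\<^sup>2 * (norm (A \<omega>))\<^sup>2 + 2 * b\<^sup>2 * (norm (B \<omega>))\<^sup>2)"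
    using le
  proof eventually_elim
    case (elim \<omega>)
    have "(norm (Z \<omega>))\<^sup>2 \<le> (a * norm (A \<omega>) + b * norm (B \<omega>))\<^sup>2"
      using elim by (intro power_mono) auto
    also have "\<dots> \<le> 2 * (a * norm (A \<omega>))\<^sup>2 + 2 * (b * norm (B \<omega>))\<^sup>2"
      using sum_squares_bound[of "a * norm (A \<omega>)" "b * norm (B \<omega>)"] by (simp add: power2_sum)
    finally show ?case by (simp add: power_mult_distrib)
  qed
  note assms(1)[measurable]
  show "(\<lambda>\<omega>. (norm (Z \<omega>))\<^sup>2) \<in> borel_measurable M" by measurable
qed

lemma (in prob_space) sq_integrable_const: "sq_integrable M (\<lambda>_. c)"
  by (simp add: sq_integrable_def)

lemma integrable_entry_mult:
  fixes A B :: "'a \<Rightarrow> real ^ 'n ^ 'm"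
  assumes [measurable]: "A \<in> borel_measurable M" "B \<in> borel_measurable M"
    and "sq_integrable M A" "sq_integrable M B"
  shows "integrable M (\<lambda>\<omega>. A \<omega> $ i $ j * B \<omega> $ i $ j)"
proof (rule Bochner_Integration.integrable_bound)
  show "integrable M (\<lambda>\<omega>. (norm (A \<omega>))\<^sup>2 + (norm (B \<omega>))\<^sup>2)"
    using assms(3,4) by (simp add: sq_integrable_def)
  show "(\<lambda>\<omega>. A \<omega> $ i $ j * B \<omega> $ i $ j) \<in> borel_measurable M"
    using assms by (intro borel_measurable_times borel_measurable_entry)
  show "AE \<omega> in M. norm (A \<omega> $ i $ j * B \<omega> $ i $ j) \<le> norm ((norm (A \<omega>))\<^sup>2 + (norm (B \<omega>))\<^sup>2)"
  proof (rule AE_I2)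
    fix \<omega>
    have "\<bar>A \<omega> $ i $ j\<bar> \<le> norm (A \<omega>)" "\<bar>B \<omega> $ i $ j\<bar> \<le> norm (B \<omega>)"
      using component_le_norm_cart[of "A \<omega> $ i" j] Finite_Cartesian_Product.norm_nth_le[of "A \<omega>" i]
        component_le_norm_cart[of "B \<omega> $ i" j] Finite_Cartesian_Product.norm_nth_le[of "B \<omega>" i]
      by linarith+
    then have "\<bar>A \<omega> $ i $ j\<bar> * \<bar>B \<omega> $ i $ j\<bar> \<le> norm (A \<omega>) * norm (B \<omega>)"
      by (intro mult_mono) auto
    also have "\<dots> \<le> (norm (A \<omega>))\<^sup>2 + (norm (B \<omega>))\<^sup>2"
      using sum_squares_bound[of "norm (A \<omega>)" "norm (B \<omega>)"] mult_nonneg_nonneg[OF norm_ge_zero[of "A \<omega>"] norm_ge_zero[of "B \<omega>"]]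
      by linarith
    finally show "norm (A \<omega> $ i $ j * B \<omega> $ i $ j) \<le> norm ((norm (A \<omega>))\<^sup>2 + (norm (B \<omega>))\<^sup>2)"
      by (simp add: abs_mult)
  qed
qed

text \<open>The \<open>F\<close>-measurable factor is pulled out of the conditional expectation
  entry by entry; square integrability makes the products integrable.\<close>

lemma (in sigma_finite_subalgebra) inner_centered:
  fixes U Y g :: "'a \<Rightarrow> real ^ 'n ^ 'm"
  assumes U_F: "U \<in> borel_measurable F" and Y: "Y \<in> borel_measurable M" and g: "g \<in> borel_measurable M"
    and sq: "sq_integrable M U" "sq_integrable M (\<lambda>\<omega>. Y \<omega> - g \<omega>)" "sq_integrable M g"
    and ce: "AE \<omega> in M. mat_cond_exp M F Y \<omega> = g \<omega>"
  shows "integrable M (\<lambda>\<omega>. U \<omega> \<bullet> (Y \<omega> - g \<omega>))" "(\<integral>\<omega>. U \<omega> \<bullet> (Y \<omega> - g \<omega>) \<partial>M) = 0"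
proof -
  have U: "U \<in> borel_measurable M" by (rule measurable_from_subalg[OF subalg U_F])
  have int_d: "integrable M (\<lambda>\<omega>. U \<omega> $ i $ j * (Y \<omega> - g \<omega>) $ i $ j)" for i j
    by (rule integrable_entry_mult[OF U borel_measurable_diff[OF Y g] sq(1,2)])
  have int_g: "integrable M (\<lambda>\<omega>. U \<omega> $ i $ j * g \<omega> $ i $ j)" for i j
    by (rule integrable_entry_mult[OF U g sq(1,3)])
  \<comment> \<open>Square integrability is assumed for \<open>Y - g\<close> and \<open>g\<close>,
    so the product with \<open>Y\<close> is assembled from these two.\<close>
  have int_Y: "integrable M (\<lambda>\<omega>. U \<omega> $ i $ j * Y \<omega> $ i $ j)" for i j
    using Bochner_Integration.integrable_add[OF int_d[of i j] int_g[of i j]]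
    by (simp flip: distrib_left)
  have zero: "(\<integral>\<omega>. U \<omega> $ i $ j * (Y \<omega> - g \<omega>) $ i $ j \<partial>M) = 0" for i j
  proof -
    note U_ij = borel_measurable_entry[OF U_F, of i j]
    note Y_ij = borel_measurable_entry[OF Y, of i j]
    have "(\<integral>\<omega>. U \<omega> $ i $ j * Y \<omega> $ i $ j \<partial>M)
        = (\<integral>\<omega>. U \<omega> $ i $ j * real_cond_exp M F (\<lambda>\<omega>. Y \<omega> $ i $ j) \<omega> \<partial>M)"
      by (rule real_cond_exp_intg(2)[OF int_Y U_ij Y_ij, symmetric])
    also have "\<dots> = (\<integral>\<omega>. U \<omega> $ i $ j * g \<omega> $ i $ j \<partial>M)"
    proof (rule integral_cong_AE)
      show "(\<lambda>\<omega>. U \<omega> $ i $ j * real_cond_exp M F (\<lambda>\<omega>. Y \<omega> $ i $ j) \<omega>) \<in> borel_measurable M"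
        by (rule borel_measurable_integrable[OF real_cond_exp_intg(1)[OF int_Y U_ij Y_ij]])
      show "AE \<omega> in M. U \<omega> $ i $ j * real_cond_exp M F (\<lambda>\<omega>. Y \<omega> $ i $ j) \<omega> = U \<omega> $ i $ j * g \<omega> $ i $ j"
        using ce by eventually_elim (simp add: mat_cond_exp_def vec_eq_iff)
    qed (rule borel_measurable_integrable[OF int_g])
    finally show ?thesis
      using Bochner_Integration.integral_diff[OF int_Y[of i j] int_g[of i j]]
      by (simp add: right_diff_distrib)
  qed
  have expand: "U \<omega> \<bullet> (Y \<omega> - g \<omega>) = (\<Sum>i\<in>UNIV. \<Sum>j\<in>UNIV. U \<omega> $ i $ j * (Y \<omega> - g \<omega>) $ i $ j)" for \<omega>
    unfolding inner_vec_def inner_real_def ..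
  show "integrable M (\<lambda>\<omega>. U \<omega> \<bullet> (Y \<omega> - g \<omega>))"
    unfolding expand by (intro Bochner_Integration.integrable_sum int_d)
  have "(\<integral>\<omega>. U \<omega> \<bullet> (Y \<omega> - g \<omega>) \<partial>M)
      = (\<Sum>i\<in>UNIV. \<Sum>j\<in>UNIV. \<integral>\<omega>. U \<omega> $ i $ j * (Y \<omega> - g \<omega>) $ i $ j \<partial>M)"
    unfolding expand by (subst Bochner_Integration.integral_sum, intro Bochner_Integration.integrable_sum int_d)
      (intro sum.cong refl Bochner_Integration.integral_sum int_d)
  then show "(\<integral>\<omega>. U \<omega> \<bullet> (Y \<omega> - g \<omega>) \<partial>M) = 0" by (simp only: zero sum.neutral_const)
qed

subsection \<open>The stochastic process\<close>

text \<open>The samples enter only through an increasing sequence of sub-sigma-algebras. The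
  recursion holds at every outcome but the lower bound \<open>\<delta>\<close> only almost surely,
  so path estimates carry over almost surely.\<close>

locale soap_process = prob_space M
  for M :: "'a measure" +
  fixes F :: "nat \<Rightarrow> 'a measure"
    and f :: "real ^ 'n ^ 'm \<Rightarrow> real"
    and grad :: "real ^ 'n ^ 'm \<Rightarrow> real ^ 'n ^ 'm"
    and G Mo V X :: "nat \<Rightarrow> 'a \<Rightarrow> real ^ 'n ^ 'm"
    and P :: "nat \<Rightarrow> 'a \<Rightarrow> real ^ 'm ^ 'm"
    and Q :: "nat \<Rightarrow> 'a \<Rightarrow> real ^ 'n ^ 'n"
    and X\<^sub>1 :: "real ^ 'n ^ 'm" and K :: nat
    and L \<sigma> \<delta> \<beta> \<theta> \<eta> \<epsilon> f_star :: real
  assumes sub: "\<And>k. subalgebra M (F k)"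
    and filtration: "\<And>k. subalgebra (F (Suc k)) (F k)"
    and gradient: "\<And>Y. GDERIV f Y :> grad Y"
    and smooth: "\<And>Y Z. norm (grad Z - grad Y) \<le> L * norm (Z - Y)"
    and lower: "\<And>Y. f_star \<le> f Y"
    and L: "L > 0" and \<beta>: "0 < \<beta>" "\<beta> < 1" and \<theta>: "0 \<le> \<theta>" "\<theta> < 1"
    and \<eta>: "\<eta> = \<delta> * (1 - \<theta>) / (2 * L)" and \<epsilon>: "\<epsilon> \<ge> 0"
    and G_measurable: "\<And>k. k \<in> {1..K} \<Longrightarrow> G k \<in> borel_measurable (F k)"
    and P_measurable: "\<And>k. k \<in> {1..K} \<Longrightarrow> P k \<in> borel_measurable (F k)"
    and Q_measurable: "\<And>k. k \<in> {1..K} \<Longrightarrow> Q k \<in> borel_measurable (F k)"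
    and unbiased: "\<And>k. k \<in> {1..K} \<Longrightarrow>
          AE \<omega> in M. mat_cond_exp M (F (k - 1)) (G k) \<omega> = grad (X k \<omega>)"
    and variance: "\<And>k. k \<in> {1..K} \<Longrightarrow>
          AE \<omega> in M. nn_cond_exp M (F (k - 1)) (\<lambda>\<omega>'. ennreal ((norm (G k \<omega>' - grad (X k \<omega>')))\<^sup>2)) \<omega>
                        \<le> ennreal (\<sigma>\<^sup>2)"
    and soap: "\<And>\<omega>. \<omega> \<in> space M \<Longrightarrow>
          generalized_soap K \<eta> \<theta> \<beta> \<epsilon> X\<^sub>1 (\<lambda>k. G k \<omega>) (\<lambda>k. P k \<omega>) (\<lambda>k. Q k \<omega>)
            (\<lambda>k. Mo k \<omega>) (\<lambda>k. V k \<omega>) (\<lambda>k. X k \<omega>)"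
    and \<delta>: "\<delta> > 0" "AE \<omega> in M. \<forall>k\<in>{1..K}. \<forall>i j. sqrt (V k \<omega> $ i $ j + \<epsilon>) \<ge> \<delta>"
begin

abbreviation noise :: "nat \<Rightarrow> 'a \<Rightarrow> real ^ 'n ^ 'm" where
  "noise k \<omega> \<equiv> G k \<omega> - grad (X k \<omega>)"

abbreviation drift :: "nat \<Rightarrow> 'a \<Rightarrow> real ^ 'n ^ 'm" where
  "drift k \<omega> \<equiv> \<theta> *\<^sub>R (Mo (k - 1) \<omega> - grad (X k \<omega>))"

lemma trajectory:
  "AE \<omega> in M. soap_trajectory f grad (\<lambda>k. G k \<omega>) (\<lambda>k. Mo k \<omega>) (\<lambda>k. V k \<omega>) (\<lambda>k. X k \<omega>)
     (\<lambda>k. P k \<omega>) (\<lambda>k. Q k \<omega>) X\<^sub>1 K L \<delta> \<beta> \<theta> \<eta> \<epsilon> f_star"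
  using \<delta>(2) AE_space
proof eventually_elim
  case (elim \<omega>)
  show ?case
    by unfold_locales
      (use gradient smooth lower L \<beta> \<theta> \<eta> \<epsilon> soap elim \<delta>(1) in auto)
qed

lemma grad_measurable: "grad \<in> borel_measurable borel"
proof -
  have "L-lipschitz_on UNIV grad"
    using smooth L by (intro lipschitz_onI) (auto simp: dist_norm)
  then show ?thesis by (intro borel_measurable_continuous_onI lipschitz_on_continuous_on)
qed

lemma space_F: "space (F k) = space M"
  using sub by (simp add: subalgebra_def)

lemma measurable_F_cong:
  assumes "g \<in> measurable (F k) N" "\<And>\<omega>. \<omega> \<in> space M \<Longrightarrow> h \<omega> = g \<omega>"
  shows "h \<in> measurable (F k) N"
  using assms measurable_cong[of "F k" h g N] by (simp add: space_F)

text \<open>The iterate runs one index ahead: \<open>X (Suc k)\<close> is known at time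
  \<open>k\<close>. Hence the drift at \<open>k\<close> is measurable before the noise at
  \<open>k\<close>, as the centering argument needs.\<close>

lemma adapted:
  "k \<le> K \<Longrightarrow> Mo k \<in> borel_measurable (F k) \<and> V k \<in> borel_measurable (F k) \<and> X (Suc k) \<in> borel_measurable (F k)"
proof (induct k)
  case 0
  have "Mo 0 \<omega> = 0" "V 0 \<omega> = 0" "X (Suc 0) \<omega> = X\<^sub>1" if "\<omega> \<in> space M" for \<omega>
    using soap[OF that] by (auto simp: generalized_soap_def)
  then show ?case
    by (auto intro: measurable_F_cong[of "\<lambda>_. 0"] measurable_F_cong[of "\<lambda>_. X\<^sub>1"])
next
  case (Suc k)
  then have k: "Suc k \<in> {1..K}" by simp
  have lift: "g \<in> borel_measurable (F (Suc k))" if "g \<in> borel_measurable (F k)" for g :: "'a \<Rightarrow> real ^ 'n ^ 'm"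
    using measurable_from_subalg[OF filtration that] .
  have IH: "Mo k \<in> borel_measurable (F (Suc k))" "V k \<in> borel_measurable (F (Suc k))"
      "X (Suc k) \<in> borel_measurable (F (Suc k))"
    using Suc by (auto intro: lift)
  note intros = borel_measurable_add borel_measurable_diff borel_measurable_scaleR borel_measurable_const
    borel_measurable_chi borel_measurable_power borel_measurable_divide
    measurable_compose[OF _ borel_measurable_sqrt]
    borel_measurable_entry borel_measurable_matrix_mult borel_measurable_transpose
    G_measurable[OF k] P_measurable[OF k] Q_measurable[OF k] IH
  have step: "Mo (Suc k) \<omega> = \<theta> *\<^sub>R Mo k \<omega> + (1 - \<theta>) *\<^sub>R G (Suc k) \<omega>"
    "V (Suc k) \<omega> = \<beta> *\<^sub>R V k \<omega>
       + (1 - \<beta>) *\<^sub>R (\<chi> i j. ((transpose (P (Suc k) \<omega>) ** G (Suc k) \<omega> ** Q (Suc k) \<omega>) $ i $ j)\<^sup>2)"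
    "X (Suc (Suc k)) \<omega> = X (Suc k) \<omega> - \<eta> *\<^sub>R (P (Suc k) \<omega> **
       (\<chi> i j. (transpose (P (Suc k) \<omega>) ** Mo (Suc k) \<omega> ** Q (Suc k) \<omega>) $ i $ j / sqrt (V (Suc k) \<omega> $ i $ j + \<epsilon>))
       ** transpose (Q (Suc k) \<omega>))"
    if "\<omega> \<in> space M" for \<omega>
    using soap[OF that] k unfolding generalized_soap_def by fastforce+
  have 1: "Mo (Suc k) \<in> borel_measurable (F (Suc k))"
    by (rule measurable_F_cong[OF _ step(1)]) (intro intros)
  have 2: "V (Suc k) \<in> borel_measurable (F (Suc k))"
    by (rule measurable_F_cong[OF _ step(2)]) (intro intros)
  have 3: "X (Suc (Suc k)) \<in> borel_measurable (F (Suc k))"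
    by (rule measurable_F_cong[OF _ step(3)]) (intro intros 1 2)
  show ?case using 1 2 3 by simp
qed

lemma X_measurable_prev: "k \<in> {1..K} \<Longrightarrow> X k \<in> borel_measurable (F (k - 1))"
  using adapted[of "k - 1"] by auto

lemma measurable_F_M: "g \<in> measurable (F k) N \<Longrightarrow> g \<in> measurable M N"
  by (rule measurable_from_subalg[OF sub])

lemma X_measurable: "k \<in> {1..K} \<Longrightarrow> X k \<in> borel_measurable M"
  using X_measurable_prev measurable_F_M by blast

lemma grad_X_measurable: "k \<in> {1..K} \<Longrightarrow> (\<lambda>\<omega>. grad (X k \<omega>)) \<in> borel_measurable M"
  using measurable_compose[OF X_measurable grad_measurable] .

lemma noise_measurable: "k \<in> {1..K} \<Longrightarrow> noise k \<in> borel_measurable M"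
  by (intro borel_measurable_diff grad_X_measurable measurable_F_M[OF G_measurable])

lemma drift_measurable_prev: "k \<in> {1..K} \<Longrightarrow> drift k \<in> borel_measurable (F (k - 1))"
  using adapted[of "k - 1"] measurable_compose[OF X_measurable_prev grad_measurable]
  by (intro borel_measurable_scaleR borel_measurable_diff borel_measurable_const) auto

lemma sigma_finite_F: "sigma_finite_subalgebra M (F k)"
  by (intro finite_measure_subalgebra_is_sigma_finite)
    (simp add: finite_measure_subalgebra_def finite_measure_subalgebra_axioms_def sub finite_measure_axioms)

text \<open>Conditional variances integrate to the total one. The computation starts with
  nonnegative integrals because integrability is part of the claim.\<close>

lemma noise_sq:
  assumes k: "k \<in> {1..K}"
  shows "sq_integrable M (noise k)" "(\<integral>\<omega>. (norm (noise k \<omega>))\<^sup>2 \<partial>M) \<le> \<sigma>\<^sup>2"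
proof -
  interpret sigma_finite_subalgebra M "F (k - 1)" by (rule sigma_finite_F)
  note [measurable] = noise_measurable[OF k]
  have "(\<integral>\<^sup>+\<omega>. ennreal ((norm (noise k \<omega>))\<^sup>2) \<partial>M)
      = (\<integral>\<^sup>+\<omega>. 1 * nn_cond_exp M (F (k - 1)) (\<lambda>\<omega>'. ennreal ((norm (noise k \<omega>'))\<^sup>2)) \<omega> \<partial>M)"
    by (subst nn_cond_exp_intg) auto
  also have "\<dots> \<le> (\<integral>\<^sup>+\<omega>. ennreal (\<sigma>\<^sup>2) \<partial>M)"
    using variance[OF k] by (intro nn_integral_mono_AE) simp
  also have "\<dots> = ennreal (\<sigma>\<^sup>2)" by (simp add: emeasure_space_1)
  finally have le: "(\<integral>\<^sup>+\<omega>. ennreal ((norm (noise k \<omega>))\<^sup>2) \<partial>M) \<le> ennreal (\<sigma>\<^sup>2)" .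
  then have int: "integrable M (\<lambda>\<omega>. (norm (noise k \<omega>))\<^sup>2)"
    by (intro integrableI_nonneg) (auto intro: le_less_trans)
  then show "sq_integrable M (noise k)" by (simp add: sq_integrable_def)
  show "(\<integral>\<omega>. (norm (noise k \<omega>))\<^sup>2 \<partial>M) \<le> \<sigma>\<^sup>2"
    using le nn_integral_eq_integral[OF int] by (simp add: ennreal_le_iff)
qed

section \<open>Second moments of the iterates and the expected bound\<close>

lemma grad_sq_integrable:
  assumes "k \<in> {1..K}" "sq_integrable M (X k)"
  shows "sq_integrable M (\<lambda>\<omega>. grad (X k \<omega>))"
proof (rule sq_integrable_bound[OF grad_X_measurable[OF assms(1)] assms(2) sq_integrable_const])
  have "norm (grad Y) \<le> L * norm Y + 1 * norm (grad 0)" for Y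
    using smooth[of Y 0] norm_triangle_ineq[of "grad Y - grad 0" "grad 0"] by simp
  then show "AE \<omega> in M. norm (grad (X k \<omega>)) \<le> L * norm (X k \<omega>) + 1 * norm (grad 0)" by simp
qed

text \<open>Joint induction: the iterate bounds its gradient through smoothness, gradient and noise
  bound \<open>G\<close>, hence the new momentum, and the growth bound for one step gives the next
  iterate.\<close>

lemma X_Mo_sq_integrable:
  "k \<le> K \<Longrightarrow> sq_integrable M (Mo k) \<and> (k < K \<longrightarrow> sq_integrable M (X (Suc k)))"
proof (induct k)
  case 0
  have "Mo 0 \<omega> = 0" "X (Suc 0) \<omega> = X\<^sub>1" if "\<omega> \<in> space M" for \<omega>
    using soap[OF that] by (auto simp: generalized_soap_def)
  then show ?case
    using sq_integrable_const[of "0 :: real ^ 'n ^ 'm"] sq_integrable_const[of X\<^sub>1]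
    unfolding sq_integrable_def
    by (auto cong: Bochner_Integration.integrable_cong)
next
  case (Suc k)
  then have k: "Suc k \<in> {1..K}" by simp
  have X: "sq_integrable M (X (Suc k))" and Mo: "sq_integrable M (Mo k)" using Suc by auto
  have G_meas: "G (Suc k) \<in> borel_measurable M" using G_measurable[OF k] by (rule measurable_F_M)
  have "norm (G (Suc k) \<omega>) \<le> 1 * norm (noise (Suc k) \<omega>) + 1 * norm (grad (X (Suc k) \<omega>))" for \<omega>
    using norm_triangle_ineq[of "noise (Suc k) \<omega>" "grad (X (Suc k) \<omega>)"] by simp
  then have G: "sq_integrable M (G (Suc k))"
    by (intro sq_integrable_bound[OF G_meas noise_sq(1)[OF k] grad_sq_integrable[OF k X]] AE_I2)
  have "norm (Mo (Suc k) \<omega>) \<le> \<theta> * norm (Mo k \<omega>) + (1 - \<theta>) * norm (G (Suc k) \<omega>)" if "\<omega> \<in> space M" for \<omega>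
  proof -
    have "Mo (Suc k) \<omega> = \<theta> *\<^sub>R Mo k \<omega> + (1 - \<theta>) *\<^sub>R G (Suc k) \<omega>"
      using soap[OF that] k unfolding generalized_soap_def by fastforce
    then show ?thesis
      using norm_triangle_ineq[of "\<theta> *\<^sub>R Mo k \<omega>" "(1 - \<theta>) *\<^sub>R G (Suc k) \<omega>"] \<theta> by simp
  qed
  then have Mo': "sq_integrable M (Mo (Suc k))"
    using adapted[of "Suc k"] k measurable_F_M
    by (intro sq_integrable_bound[OF _ Mo G] AE_I2) auto
  have "sq_integrable M (X (Suc (Suc k)))" if "Suc k < K"
  proof (rule sq_integrable_bound[OF X_measurable X Mo'])
    show "Suc (Suc k) \<in> {1..K}" using that by simp
    show "AE \<omega> in M. norm (X (Suc (Suc k)) \<omega>) \<le> 1 * norm (X (Suc k) \<omega>) + \<eta> / \<delta> * norm (Mo (Suc k) \<omega>)"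
      using trajectory
    proof eventually_elim
      case (elim \<omega>)
      show ?case using soap_trajectory.step_norm_le[OF elim k] by simp
    qed
  qed
  with Mo' show ?case by simp
qed

lemma X_sq_integrable: "k \<in> {1..K} \<Longrightarrow> sq_integrable M (X k)"
  using X_Mo_sq_integrable[of "k - 1"] by auto

lemma drift_sq_integrable:
  assumes k: "k \<in> {1..K}"
  shows "sq_integrable M (drift k)"
proof (rule sq_integrable_bound)
  show "drift k \<in> borel_measurable M" using drift_measurable_prev[OF k] by (rule measurable_F_M)
  show "sq_integrable M (Mo (k - 1))" using X_Mo_sq_integrable[of "k - 1"] k by force
  show "sq_integrable M (\<lambda>\<omega>. grad (X k \<omega>))" by (rule grad_sq_integrable[OF k X_sq_integrable[OF k]])
  have "norm (drift k \<omega>) \<le> \<theta> * norm (Mo (k - 1) \<omega>) + \<theta> * norm (grad (X k \<omega>))" for \<omega>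
    using mult_left_mono[OF norm_triangle_ineq4[of "Mo (k - 1) \<omega>" "grad (X k \<omega>)"], of \<theta>] \<theta>
    by (simp add: distrib_left)
  then show "AE \<omega> in M. norm (drift k \<omega>) \<le> \<theta> * norm (Mo (k - 1) \<omega>) + \<theta> * norm (grad (X k \<omega>))" by simp
qed

lemma drift_noise:
  assumes k: "k \<in> {1..K}"
  shows "integrable M (\<lambda>\<omega>. drift k \<omega> \<bullet> noise k \<omega>)" "(\<integral>\<omega>. drift k \<omega> \<bullet> noise k \<omega> \<partial>M) = 0"
proof -
  interpret sigma_finite_subalgebra M "F (k - 1)" by (rule sigma_finite_F)
  note cross = inner_centered[OF drift_measurable_prev[OF k] measurable_F_M[OF G_measurable[OF k]]
      grad_X_measurable[OF k] drift_sq_integrable[OF k] noise_sq(1)[OF k]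
      grad_sq_integrable[OF k X_sq_integrable[OF k]] unbiased[OF k]]
  show "integrable M (\<lambda>\<omega>. drift k \<omega> \<bullet> noise k \<omega>)" by (rule cross(1))
  show "(\<integral>\<omega>. drift k \<omega> \<bullet> noise k \<omega> \<partial>M) = 0" by (rule cross(2))
qed

lemma integrable_nuclear_norm:
  assumes k: "k \<in> {1..K}"
  shows "integrable M (\<lambda>\<omega>. nuclear_norm (grad (X k \<omega>)))"
proof (rule Bochner_Integration.integrable_bound)
  show "integrable M (\<lambda>\<omega>. real CARD('m) * (1 + (norm (grad (X k \<omega>)))\<^sup>2))"
    using grad_sq_integrable[OF k X_sq_integrable[OF k]] by (simp add: sq_integrable_def)
  show "(\<lambda>\<omega>. nuclear_norm (grad (X k \<omega>))) \<in> borel_measurable M"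
    using grad_X_measurable[OF k] borel_measurable_nuclear_norm by (rule measurable_compose)
  have "nuclear_norm A \<le> real CARD('m) * (1 + (norm A)\<^sup>2)" for A :: "real ^ 'n ^ 'm"
  proof -
    have "norm A \<le> 1 + (norm A)\<^sup>2"
      using sum_squares_bound[of 1 "norm A", simplified] norm_ge_zero[of A] by linarith
    then have "real CARD('m) * norm A \<le> real CARD('m) * (1 + (norm A)\<^sup>2)" by (rule mult_left_mono) simp
    then show ?thesis using nuclear_norm_le_norm[of A] by linarith
  qed
  then show "AE \<omega> in M. norm (nuclear_norm (grad (X k \<omega>)))
      \<le> norm (real CARD('m) * (1 + (norm (grad (X k \<omega>)))\<^sup>2))"
    by (simp add: nuclear_norm_nonneg)
qed

text \<open>The pathwise bound is affine in the sum of cross terms, which has mean zero, and in the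
  total squared noise, whose mean is at most \<open>real K * \<sigma>\<^sup>2\<close>.\<close>

lemma sum_expected_nuclear_norm_le:
  assumes s: "s > 0" and c: "c > 0"
  shows "(\<Sum>k=1..K. \<integral>\<omega>. nuclear_norm (grad (X k \<omega>)) \<partial>M)
    \<le> (s / 2 + 2 / s) * (2 / \<eta> * ((f X\<^sub>1 - f_star) + (1 / (4 * L)) *
          (2 * L * (f X\<^sub>1 - f_star) + (1 - \<theta>)\<^sup>2 * (real K * \<sigma>\<^sup>2))))
      + (1 / (2 * s)) * ((2 * (real K * \<sigma>\<^sup>2) + real CARD('m) * (real K * \<epsilon>)) / c + real CARD('m) * (real K * c))"
proof -
  define a where "a = (s / 2 + 2 / s) * (2 / \<eta>)"
  define Dl where "Dl = f X\<^sub>1 - f_star"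
  define l where "l = 1 / (4 * L)"
  define t where "t = 1 / (2 * s)"
  define d where "d = inverse c"
  \<comment> \<open>Here \<open>U\<close> stands for the sum of the cross terms and \<open>W\<close>
    for the total squared noise.\<close>
  define B where "B U W = a * (Dl + l * (2 * L * Dl + 2 * (1 - \<theta>) * U + (1 - \<theta>)\<^sup>2 * W))
      + t * ((2 * W + real CARD('m) * (real K * \<epsilon>)) * d + real CARD('m) * (real K * c))" for U W
  define C where "C \<omega> = (\<Sum>k=1..K. drift k \<omega> \<bullet> noise k \<omega>)" for \<omega>
  define \<Xi> where "\<Xi> \<omega> = (\<Sum>k=1..K. (norm (noise k \<omega>))\<^sup>2)" for \<omega>
  have \<eta>_pos: "\<eta> > 0" using \<eta> \<delta>(1) \<theta> L by simp
  have a: "a \<ge> 0" using s \<eta>_pos by (simp add: a_def)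
  have intC: "integrable M C"
    unfolding C_def by (intro Bochner_Integration.integrable_sum drift_noise)
  have "(\<integral>\<omega>. C \<omega> \<partial>M) = (\<Sum>k=1..K. \<integral>\<omega>. drift k \<omega> \<bullet> noise k \<omega> \<partial>M)"
    unfolding C_def by (intro Bochner_Integration.integral_sum drift_noise)
  also have "\<dots> = 0" by (intro sum.neutral ballI drift_noise)
  finally have C0: "(\<integral>\<omega>. C \<omega> \<partial>M) = 0" .
  have int\<Xi>: "integrable M \<Xi>"
    unfolding \<Xi>_def using noise_sq(1) by (auto intro!: Bochner_Integration.integrable_sum simp: sq_integrable_def)
  have "(\<integral>\<omega>. \<Xi> \<omega> \<partial>M) = (\<Sum>k=1..K. \<integral>\<omega>. (norm (noise k \<omega>))\<^sup>2 \<partial>M)"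
    unfolding \<Xi>_def using noise_sq(1) by (intro Bochner_Integration.integral_sum) (auto simp: sq_integrable_def)
  also have "\<dots> \<le> (\<Sum>k=1..K. \<sigma>\<^sup>2)" by (intro sum_mono noise_sq)
  finally have \<Xi>_le: "(\<integral>\<omega>. \<Xi> \<omega> \<partial>M) \<le> real K * \<sigma>\<^sup>2" by simp
  define b1 where "b1 = a * l * 2 * (1 - \<theta>)"
  define b2 where "b2 = a * l * (1 - \<theta>)\<^sup>2 + t * 2 * d"
  have B_affine: "B U W = B 0 0 + b1 * U + b2 * W" for U W
    unfolding B_def b1_def b2_def by (simp add: algebra_simps)
  \<comment> \<open>For the noise only an upper bound on the mean is known, so its coefficient must
    be nonnegative; the cross terms cancel for either sign of \<open>b1\<close>.\<close>
  have b2: "0 \<le> b2" unfolding b2_def using a L s c by (auto simp: l_def t_def d_def)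
  have path: "AE \<omega> in M. (\<Sum>k=1..K. nuclear_norm (grad (X k \<omega>))) \<le> B (C \<omega>) (\<Xi> \<omega>)"
    using trajectory
  proof eventually_elim
    case (elim \<omega>)
    interpret tr: soap_trajectory f grad "\<lambda>k. G k \<omega>" "\<lambda>k. Mo k \<omega>" "\<lambda>k. V k \<omega>" "\<lambda>k. X k \<omega>"
      "\<lambda>k. P k \<omega>" "\<lambda>k. Q k \<omega>" X\<^sub>1 K L \<delta> \<beta> \<theta> \<eta> \<epsilon> f_star by (rule elim)
    define A where "A = (\<Sum>k=1..K. tr.grad_energy k)"
    define E where "E = Dl + l * (2 * L * Dl + 2 * (1 - \<theta>) * C \<omega> + (1 - \<theta>)\<^sup>2 * \<Xi> \<omega>)"
    have "\<eta> / 2 * A \<le> E"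
      using tr.sum_grad_energy unfolding A_def E_def Dl_def C_def \<Xi>_def l_def .
    then have "A \<le> 2 / \<eta> * E" using \<eta>_pos by (simp add: field_simps)
    then have "(s / 2 + 2 / s) * A \<le> (s / 2 + 2 / s) * (2 / \<eta> * E)"
      using s by (intro mult_left_mono) auto
    then show ?case
      using tr.sum_nuclear_norm_le[OF s c]
      unfolding B_def a_def mult.assoc A_def[symmetric] \<Xi>_def[symmetric] t_def[symmetric] d_def divide_inverse[of _ c]
        E_def[unfolded mult.assoc, symmetric]
      by linarith
  qed
  have "(\<Sum>k=1..K. \<integral>\<omega>. nuclear_norm (grad (X k \<omega>)) \<partial>M)
      = (\<integral>\<omega>. (\<Sum>k=1..K. nuclear_norm (grad (X k \<omega>))) \<partial>M)"
    using integrable_nuclear_norm by (intro Bochner_Integration.integral_sum[symmetric])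
  also have "\<dots> \<le> (\<integral>\<omega>. B (C \<omega>) (\<Xi> \<omega>) \<partial>M)"
  proof (rule integral_mono_AE[OF _ _ path])
    show "integrable M (\<lambda>\<omega>. \<Sum>k=1..K. nuclear_norm (grad (X k \<omega>)))"
      using integrable_nuclear_norm by (intro Bochner_Integration.integrable_sum)
    show "integrable M (\<lambda>\<omega>. B (C \<omega>) (\<Xi> \<omega>))"
      using intC int\<Xi> by (subst B_affine) simp
  qed
  also have "\<dots> = (\<integral>\<omega>. B 0 0 + b1 * C \<omega> + b2 * \<Xi> \<omega> \<partial>M)" by (subst B_affine) (rule refl)
  also have "\<dots> = B 0 0 + b2 * (\<integral>\<omega>. \<Xi> \<omega> \<partial>M)"
    using intC int\<Xi> by (simp add: C0 prob_space)
  also have "\<dots> \<le> B 0 0 + b2 * (real K * \<sigma>\<^sup>2)"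
    using mult_left_mono[OF \<Xi>_le b2] by simp
  also have "\<dots> = B 0 (real K * \<sigma>\<^sup>2)" using B_affine[of 0 "real K * \<sigma>\<^sup>2"] by simp
  finally show ?thesis
    unfolding B_def a_def Dl_def l_def t_def d_def
    by (simp only: mult.assoc mult_zero_right add_0_right divide_inverse[of _ c])
qed

end

section \<open>Choice of the parameters and the final constants\<close>

theorem theorem1:
  fixes M :: "'a measure" and D :: "'z measure"
    and \<zeta> :: "nat \<Rightarrow> 'a \<Rightarrow> 'z"
    and floss :: "real ^ 'n ^ 'm \<Rightarrow> 'z \<Rightarrow> real"
    and f :: "real ^ 'n ^ 'm \<Rightarrow> real"
    and grad :: "real ^ 'n ^ 'm \<Rightarrow> real ^ 'n ^ 'm"
    and G Mo V X :: "nat \<Rightarrow> 'a \<Rightarrow> real ^ 'n ^ 'm"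
    and P :: "nat \<Rightarrow> 'a \<Rightarrow> real ^ 'm ^ 'm"
    and Q :: "nat \<Rightarrow> 'a \<Rightarrow> real ^ 'n ^ 'n"
    and X\<^sub>1 :: "real ^ 'n ^ 'm"
    and K :: nat
    and L \<sigma> \<delta> \<gamma> \<tau> \<beta> \<theta> \<eta> \<epsilon> \<sigma>\<^sub>h f_star :: real
  defines "F \<equiv> sample_filtration M D \<zeta>"
  assumes M: "prob_space M" and D: "prob_space D"
    and samples: "\<And>k. k \<ge> 1 \<Longrightarrow> \<zeta> k \<in> measurable M D"
    and f_integrable: "\<And>Y. integrable D (floss Y)"
    and f_expectation: "\<And>Y. f Y = (\<integral>z. floss Y z \<partial>D)"
    and gradient: "\<And>Y. GDERIV f Y :> grad Y"
    and bounded_below: "bdd_below (range f)"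
    and f_star: "f_star = (INF Y. f Y)"
    and constants: "L > 0" "\<sigma> \<ge> 0" "K \<ge> 1"
    and G_measurable: "\<And>k. k \<in> {1..K} \<Longrightarrow> G k \<in> borel_measurable (F k)"
    and P_measurable: "\<And>k. k \<in> {1..K} \<Longrightarrow> P k \<in> borel_measurable (F k)"
    and Q_measurable: "\<And>k. k \<in> {1..K} \<Longrightarrow> Q k \<in> borel_measurable (F k)"
    and smoothness: "\<And>Y Z. norm (grad Z - grad Y) \<le> L * norm (Z - Y)"
    and unbiased: "\<And>k. k \<in> {1..K} \<Longrightarrow>
          AE \<omega> in M. mat_cond_exp M (F (k - 1)) (G k) \<omega> = grad (X k \<omega>)"
    and variance: "\<And>k. k \<in> {1..K} \<Longrightarrow>
          AE \<omega> in M. nn_cond_exp M (F (k - 1)) (\<lambda>\<omega>'. ennreal ((norm (G k \<omega>' - grad (X k \<omega>')))\<^sup>2)) \<omega>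
                        \<le> ennreal (\<sigma>\<^sup>2)"
    and algorithm: "\<And>\<omega>. \<omega> \<in> space M \<Longrightarrow>
          generalized_soap K \<eta> \<theta> \<beta> \<epsilon> X\<^sub>1 (\<lambda>k. G k \<omega>) (\<lambda>k. P k \<omega>) (\<lambda>k. Q k \<omega>)
            (\<lambda>k. Mo k \<omega>) (\<lambda>k. V k \<omega>) (\<lambda>k. X k \<omega>)"
    and delta: "\<delta> > 0"
          "AE \<omega> in M. \<forall>k\<in>{1..K}. \<forall>i j. sqrt (V k \<omega> $ i $ j + \<epsilon>) \<ge> \<delta>"
    and gamma: "0 < \<gamma>" "\<gamma> \<le> 1"
    and tau: "0 < \<tau>" "\<tau> \<le> 1"
    and beta: "0 < \<beta>" "\<beta> < 1"
    and sigma_hat: "\<sigma>\<^sub>h > 0"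
          "\<sigma>\<^sub>h\<^sup>2 = max (\<sigma>\<^sup>2) (L * (f X\<^sub>1 - f_star) / (real K * \<gamma>\<^sup>2))"
    and theta: "1 - \<theta> = sqrt (L * (f X\<^sub>1 - f_star) / (real K * \<sigma>\<^sub>h\<^sup>2))"
    and eta: "\<eta> = sqrt (\<delta>\<^sup>2 * (f X\<^sub>1 - f_star) / (4 * L * real K * \<sigma>\<^sub>h\<^sup>2))"
    and epsilon: "\<epsilon> = \<tau> * \<sigma>\<^sub>h\<^sup>2 / (real CARD('m) + real CARD('n))"
  shows "(\<forall>k\<in>{1..K}. integrable M (\<lambda>\<omega>. nuclear_norm (grad (X k \<omega>)))) \<and>
         (1 / real K) * (\<Sum>k=1..K. \<integral>\<omega>. nuclear_norm (grad (X k \<omega>)) \<partial>M)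
         \<le> (2 * sqrt (real CARD('m) + real CARD('n)) + 16 * \<sigma>\<^sub>h / \<delta>)
            * root 4 (\<sigma>\<^sub>h\<^sup>2 * L * (f X\<^sub>1 - f_star) / real K)"
proof -
  interpret prob_space M by (rule M)
  define Dl where "Dl = f X\<^sub>1 - f_star"
  define p where "p = 1 - \<theta>"
  have lower: "f_star \<le> f Y" for Y
    unfolding f_star using bounded_below by (intro cINF_lower) auto
  have Dl: "Dl \<ge> 0" using lower[of X\<^sub>1] by (simp add: Dl_def)
  have K: "real K > 0" using constants(3) by simp
  have p: "p = sqrt (L * Dl / (real K * \<sigma>\<^sub>h\<^sup>2))" using theta by (simp add: p_def Dl_def)
  have p0: "p \<ge> 0" unfolding p using constants Dl by simp
  have p_sq: "p\<^sup>2 * (real K * \<sigma>\<^sub>h\<^sup>2) = L * Dl"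
    unfolding p using constants Dl K sigma_hat(1) by simp
  have \<sigma>_le: "\<sigma>\<^sup>2 \<le> \<sigma>\<^sub>h\<^sup>2" unfolding sigma_hat(2) by simp
  \<comment> \<open>The second entry of the maximum defining \<open>\<sigma>\<^sub>h\<close> gives
    \<open>p \<le> \<gamma>\<close>, and \<open>\<gamma> \<le> 1\<close>.\<close>
  have p1: "p \<le> 1"
  proof -
    have "L * Dl / (real K * \<gamma>\<^sup>2) \<le> \<sigma>\<^sub>h\<^sup>2" unfolding sigma_hat(2) Dl_def by simp
    then have "L * Dl \<le> \<gamma>\<^sup>2 * (real K * \<sigma>\<^sub>h\<^sup>2)"
      using K gamma(1) by (simp add: field_simps)
    also have "\<dots> \<le> 1 * (real K * \<sigma>\<^sub>h\<^sup>2)"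
      using gamma K by (intro mult_right_mono power_le_one) auto
    finally have "L * Dl / (real K * \<sigma>\<^sub>h\<^sup>2) \<le> 1" using K sigma_hat(1) by simp
    then show ?thesis unfolding p by simp
  qed
  have eta_eq: "\<eta> = \<delta> * p / (2 * L)"
  proof -
    have "\<delta>\<^sup>2 * Dl / (4 * L * real K * \<sigma>\<^sub>h\<^sup>2) = (\<delta> / (2 * L))\<^sup>2 * (L * Dl / (real K * \<sigma>\<^sub>h\<^sup>2))"
      using constants(1) by (simp add: power2_eq_square)
    then have "\<eta> = sqrt ((\<delta> / (2 * L))\<^sup>2) * p"
      unfolding eta p Dl_def[symmetric] by (simp only: real_sqrt_mult)
    then show ?thesis using delta(1) constants(1) by simp
  qed
  have \<epsilon>: "\<epsilon> \<ge> 0" unfolding epsilon using tau by simp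
  \<comment> \<open>Since \<open>L * Dl\<close> equals
    \<open>p\<^sup>2 * (real K * \<sigma>\<^sub>h\<^sup>2)\<close>, the fourth root in the claim is
    simply \<open>q * \<sigma>\<^sub>h\<close>.\<close>
  define q where "q = sqrt p"
  have q: "0 \<le> q" "q \<le> 1" "q\<^sup>2 = p" using p0 p1 by (auto simp: q_def)
  have rhs: "root 4 (\<sigma>\<^sub>h\<^sup>2 * L * (f X\<^sub>1 - f_star) / real K) = q * \<sigma>\<^sub>h"
  proof -
    have "\<sigma>\<^sub>h\<^sup>2 * L * Dl / real K = \<sigma>\<^sub>h\<^sup>2 * (p\<^sup>2 * (real K * \<sigma>\<^sub>h\<^sup>2)) / real K"
      by (simp add: p_sq mult.assoc)
    also have "\<dots> = (q * \<sigma>\<^sub>h) ^ 4"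
      using K by (simp add: q(3)[symmetric] power_mult_distrib flip: power_add power_mult)
    finally show ?thesis
      using q(1) sigma_hat(1) by (simp add: Dl_def real_root_power_cancel)
  qed
  show ?thesis
  proof (cases "p = 0")
    \<comment> \<open>With \<open>p = 0\<close> the gap vanishes: \<open>X\<^sub>1\<close> is a
      minimizer with zero gradient, the learning rate is zero, and all iterates stay there. The
      process locale requires \<open>\<theta> < 1\<close> and does not cover this case.\<close>
    case True
    then have "Dl = 0" using p_sq constants(1) by simp
    then have "(norm (grad X\<^sub>1))\<^sup>2 \<le> 0"
      using smooth_gradient_bound[OF gradient smoothness constants(1) lower, of X\<^sub>1] by (simp add: Dl_def)
    then have grad0: "grad X\<^sub>1 = 0" by simp
    have nuc0: "nuclear_norm (0 :: real ^ 'n ^ 'm) = 0"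
      using nuclear_norm_le_norm[of "0 :: real ^ 'n ^ 'm"] nuclear_norm_nonneg[of "0 :: real ^ 'n ^ 'm"] by simp
    have const: "X k \<omega> = X\<^sub>1" if "\<omega> \<in> space M" "k \<in> {1..K}" for k \<omega>
    proof -
      have "X (Suc n) \<omega> = X\<^sub>1" if "n < K" for n
        using that
      proof (induct n)
        case 0
        then show ?case using algorithm[OF \<open>\<omega> \<in> space M\<close>] by (simp add: generalized_soap_def)
      next
        case (Suc n)
        then have "Suc n \<in> {1..K}" by simp
        then have "X (Suc n + 1) \<omega> = X (Suc n) \<omega>"
          using algorithm[OF \<open>\<omega> \<in> space M\<close>] True unfolding generalized_soap_def by (simp add: eta_eq)
        then show ?case using Suc by simp
      qed
      from this[of "k - 1"] that show ?thesis by (cases k) auto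
    qed
    have "nuclear_norm (grad (X k \<omega>)) = 0" if "\<omega> \<in> space M" "k \<in> {1..K}" for k \<omega>
      using const[OF that] grad0 nuc0 by simp
    then have "integrable M (\<lambda>\<omega>. nuclear_norm (grad (X k \<omega>)))"
        "(\<integral>\<omega>. nuclear_norm (grad (X k \<omega>)) \<partial>M) = 0" if "k \<in> {1..K}" for k
      using that Bochner_Integration.integrable_cong[of M M "\<lambda>\<omega>. nuclear_norm (grad (X k \<omega>))" "\<lambda>_. 0"]
        Bochner_Integration.integral_cong[of M M "\<lambda>\<omega>. nuclear_norm (grad (X k \<omega>))" "\<lambda>_. 0"] by auto
    then show ?thesis unfolding rhs using q(3) True by simp
  next
    case False
    then have p_pos: "p > 0" and q_pos: "q > 0" using p0 by (auto simp: q_def)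
    interpret soap_process M F f grad G Mo V X P Q X\<^sub>1 K L \<sigma> \<delta> \<beta> \<theta> \<eta> \<epsilon> f_star
    proof unfold_locales
      show "subalgebra M (F k)" for k
        unfolding F_def by (rule subalgebra_sample_filtration[OF samples])
      show "subalgebra (F (Suc k)) (F k)" for k
        unfolding F_def by (rule sample_filtration_mono) simp
      show "0 \<le> \<theta>" "\<theta> < 1" "\<eta> = \<delta> * (1 - \<theta>) / (2 * L)"
        using p1 p_pos eta_eq by (auto simp: p_def)
    qed (fact gradient smoothness lower constants beta \<epsilon> G_measurable P_measurable Q_measurable
        unbiased variance algorithm delta)+
    define m where "m = real CARD('m)"
    have m: "m > 0" by (simp add: m_def)
    define S where "S = (\<Sum>k=1..K. \<integral>\<omega>. nuclear_norm (grad (X k \<omega>)) \<partial>M)"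
    \<comment> \<open>This \<open>s\<close> gives \<open>s / 2 + 2 / s = (1 + p) / q\<close>, so the energy contributes at most \<open>14 \<sigma>\<^sub>h / \<delta>\<close>.\<close>
    define s where "s = 2 / q"
    \<comment> \<open>Makes both contributions to \<open>B\<close>, one with \<open>c\<close> in the
      denominator and one proportional to \<open>c\<close>, multiples of
      \<open>real K * sqrt m * \<sigma>\<^sub>h\<close>.\<close>
    define c where "c = \<sigma>\<^sub>h / sqrt m"
    define A where "A = 2 / \<eta> * (Dl + (1 / (4 * L)) * (2 * L * Dl + p\<^sup>2 * (real K * \<sigma>\<^sup>2)))"
    define B where "B = (2 * (real K * \<sigma>\<^sup>2) + m * (real K * \<epsilon>)) / c + m * (real K * c)"
    have s: "s > 0" and c: "c > 0" using q_pos m sigma_hat(1) by (auto simp: s_def c_def)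
    have S_le: "S \<le> (s / 2 + 2 / s) * A + (1 / (2 * s)) * B"
      unfolding S_def A_def B_def Dl_def p_def m_def by (rule sum_expected_nuclear_norm_le[OF s c])
    \<comment> \<open>The noise term is at most \<open>L * Dl\<close> by \<open>p_sq\<close>, so the
      bracket is at most \<open>(1 + 3 / 4) * Dl\<close>. The factor \<open>2 / \<eta>\<close> with
      \<open>\<eta> = \<delta> * p / (2 * L)\<close> turns \<open>7 / 4\<close> into 7.\<close>
    have A_le: "A \<le> 7 * (real K * p * \<sigma>\<^sub>h\<^sup>2 / \<delta>)"
    proof -
      have "p\<^sup>2 * (real K * \<sigma>\<^sup>2) \<le> p\<^sup>2 * (real K * \<sigma>\<^sub>h\<^sup>2)"
        using \<sigma>_le K by (intro mult_left_mono) auto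
      then have "2 * L * Dl + p\<^sup>2 * (real K * \<sigma>\<^sup>2) \<le> 3 * (L * Dl)"
        unfolding p_sq by (simp add: mult.commute)
      then have "(1 / (4 * L)) * (2 * L * Dl + p\<^sup>2 * (real K * \<sigma>\<^sup>2)) \<le> (1 / (4 * L)) * (3 * (L * Dl))"
        using constants(1) by (intro mult_left_mono) auto
      also have "\<dots> = 3 / 4 * Dl" using constants(1) by simp
      finally have "A \<le> 2 / \<eta> * (7 / 4 * Dl)"
        unfolding A_def using eta_eq p_pos delta(1) constants(1) by (intro mult_left_mono) auto
      also have "\<dots> = 7 * (L * Dl) / (\<delta> * p)"
        using p_pos delta(1) constants(1) by (simp add: eta_eq field_simps)
      also have "\<dots> = 7 * (real K * p * \<sigma>\<^sub>h\<^sup>2 / \<delta>)"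
        using p_pos delta(1) unfolding p_sq[symmetric] by (simp add: field_simps power2_eq_square)
      finally show ?thesis .
    qed
    have B_le: "B \<le> 4 * (real K * sqrt m * \<sigma>\<^sub>h)"
    proof -
      \<comment> \<open>The denominator \<open>m + n\<close> of \<open>\<epsilon>\<close>
        compensates the sum over \<open>m\<close> rows; together with twice the variance this gives
        the factor 3 below.\<close>
      have "m * \<epsilon> \<le> \<sigma>\<^sub>h\<^sup>2"
      proof -
        have "m * \<epsilon> = \<tau> * (m / (m + real CARD('n))) * \<sigma>\<^sub>h\<^sup>2" by (simp add: epsilon m_def)
        also have "\<dots> \<le> 1 * \<sigma>\<^sub>h\<^sup>2"
          using tau m by (intro mult_right_mono mult_le_one) (auto simp: field_simps)
        finally show ?thesis by simp
      qed
      then have "2 * (real K * \<sigma>\<^sup>2) + real K * (m * \<epsilon>) \<le> 2 * (real K * \<sigma>\<^sub>h\<^sup>2) + real K * \<sigma>\<^sub>h\<^sup>2"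
        using \<sigma>_le K by (intro add_mono mult_left_mono) auto
      then have "(2 * (real K * \<sigma>\<^sup>2) + m * (real K * \<epsilon>)) / c \<le> 3 * (real K * \<sigma>\<^sub>h\<^sup>2) / c"
        using c by (intro divide_right_mono) (simp_all add: mult_ac)
      also have "\<dots> = 3 * (real K * sqrt m * \<sigma>\<^sub>h)"
        using m sigma_hat(1) by (simp add: c_def power2_eq_square)
      finally have "(2 * (real K * \<sigma>\<^sup>2) + m * (real K * \<epsilon>)) / c \<le> 3 * (real K * sqrt m * \<sigma>\<^sub>h)" .
      moreover have "m * (real K * c) = real K * sqrt m * \<sigma>\<^sub>h"
      proof -
        have "m * (real K * c) = real K * (m / sqrt m) * \<sigma>\<^sub>h" by (simp add: c_def)
        then show ?thesis using m by (simp add: real_div_sqrt)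
      qed
      ultimately show ?thesis unfolding B_def by linarith
    qed
    have "S \<le> (s / 2 + 2 / s) * (7 * (real K * p * \<sigma>\<^sub>h\<^sup>2 / \<delta>)) + (1 / (2 * s)) * (4 * (real K * sqrt m * \<sigma>\<^sub>h))"
      by (rule order_trans[OF S_le]) (use s A_le B_le in \<open>intro add_mono mult_left_mono; simp\<close>)
    also have "\<dots> = real K * (q * \<sigma>\<^sub>h) * (7 * (1 + p) * \<sigma>\<^sub>h / \<delta> + sqrt m)"
      using q_pos delta(1) by (simp add: s_def q(3)[symmetric] field_simps power2_eq_square)
    \<comment> \<open>Here \<open>p \<le> 1\<close> gives
      \<open>7 * (1 + p) \<le> 14 \<le> 16\<close>, and the dimension term has slack as
      well.\<close>
    also have "\<dots> \<le> real K * (q * \<sigma>\<^sub>h) * (16 * \<sigma>\<^sub>h / \<delta> + 2 * sqrt (m + real CARD('n)))"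
    proof (intro mult_left_mono add_mono divide_right_mono mult_right_mono)
      have "sqrt m \<le> sqrt (m + real CARD('n))" by simp
      moreover have "0 \<le> sqrt (m + real CARD('n))" using m by simp
      ultimately show "sqrt m \<le> 2 * sqrt (m + real CARD('n))" by linarith
    qed (use p1 q_pos sigma_hat(1) delta(1) in auto)
    finally have "(1 / real K) * S \<le> (2 * sqrt (m + real CARD('n)) + 16 * \<sigma>\<^sub>h / \<delta>) * (q * \<sigma>\<^sub>h)"
      using K by (simp add: field_simps)
    then show ?thesis
      unfolding rhs S_def[symmetric] m_def[symmetric] using integrable_nuclear_norm by blast
  qed
qed

end
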